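(* Let $\Gamma$ be the integer lattice graph, let $\Sigma$ be a perfect dominating set of $\Gamma$, let $\Lambda=\Gamma\setminus\Sigma$ be the complementary graph of $\Sigma$ in $\Gamma$, and let $M(\Lambda)$ be the planar map of $\Lambda$ induced by the standard embedding of $\Gamma$ in $\mathbb{R}^2$. Assume that all belts of $M(\Lambda)$ have lengths divisible by 4; in other words, assume that the components of the subgraph $\Gamma\setminus\Lambda$ of $\Gamma$ induced by $\Sigma$ all have vertex sets of odd cardinality. Then $\Lambda$ has DETGCs and RETGCs that yield corresponding PFCs of $M(\Lambda)$.
   Context: The integer lattice graph $\Gamma$ has vertex set $\mathbb{Z}^2$, two vertices being adjacent iff their Euclidean distance is 1. A perfect dominating set (PDS) of a graph $\Gamma$ is a vertex subset $\Sigma$ such that each vertex not in $\Sigma$ is adjacent to exactly one element of $\Sigma$; $\Gamma\setminus\Sigma$ is the graph obtained by deleting the vertices of $\Sigma$ (here it is cubic). Write $[3]_0=\{0,1,2,3\}$. For a cubic graph $G$: a set $S_0\subseteq V(G)$ is an efficient dominating set (EDS) if $|N_G[v]\cap S_0|=1$ for every $v\in V(G)$. A total coloring colors vertices and edges so that no two incident or adjacent elements get the same color. An efficient total coloring (ETC) of $G$ is a total coloring $\mu:V(G)\cup E(G)\to[3]_0$ such that for each vertex $v$ the restriction of $\mu$ to $N_G[v]$ is a bijection onto $[3]_0$, and the four vertex color classes partition $V(G)$ into EDSs. An ETGC is an ETC in which every 4-cycle of $G$ has each of the four colors exactly once on its vertices and exactly once on its edges. In a map (embedding with faces being disks), a belt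 is a face boundary cycle. Given an ETGC of a map, a belt is directed (resp. reversed) if each color-0 edge $e$ on it lies in the clockwise (resp. counterclockwise) direction from a color-0 vertex $v$ of the belt, with distance 1 from $v$ to the nearest end-vertex of $e$. An ETGC is a DETGC (resp. RETGC) if every belt is directed (resp. reversed). An ETGC is periodic if for each belt, traversed in one of its two directions, the alternating cyclic sequence of colors (vertex, edge, vertex, edge, ...) is a concatenation of copies of $a,b,c,a,d,c,b,d$ for some $\{a,b,c,d\}=[3]_0$ (odd positions vertex colors, even positions edge colors). The PFC corresponding to a periodic ETGC $\mu'$ is the face coloring $\mu$ assigning to the face with belt $B$ the permutation $\mu(B)=abc$ of $\{1,2,3\}$, where $0,a,b,c$ are the $\mu'$-colors of four consecutive vertices of $B$ in clockwise order starting at a vertex of color $0$; adjacent faces receive distinct permutations. *)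

theory Defs
  imports "HOL-Analysis.Analysis" "HOL-Combinatorics.Multiset_Permutations"
begin

section \<open>Simple graphs\<close>

text \<open>A graph is a pair of a vertex set and a set of two-element sets of vertices.\<close>

type_synonym 'v graph = "'v set \<times> 'v set set"

abbreviation verts :: "'v graph \<Rightarrow> 'v set" where "verts \<equiv> fst"
abbreviation edges :: "'v graph \<Rightarrow> 'v set set" where "edges \<equiv> snd"

definition adjacent :: "'v graph \<Rightarrow> 'v \<Rightarrow> 'v \<Rightarrow> bool" where
  "adjacent G u v \<longleftrightarrow> {u, v} \<in> edges G"

definition closed_nbhd :: "'v graph \<Rightarrow> 'v \<Rightarrow> 'v set" where
  "closed_nbhd G v = insert v {u. adjacent G v u}"

definition induced_subgraph :: "'v graph \<Rightarrow> 'v set \<Rightarrow> 'v graph" where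
  "induced_subgraph G S = (verts G \<inter> S, {e \<in> edges G. e \<subseteq> S})"

definition delete_vertices :: "'v graph \<Rightarrow> 'v set \<Rightarrow> 'v graph" where
  "delete_vertices G S = induced_subgraph G (verts G - S)"

definition graph_components :: "'v graph \<Rightarrow> 'v set set" where
  "graph_components G = (\<lambda>v. {u. (adjacent G)\<^sup>*\<^sup>* v u}) ` verts G"

definition perfect_dominating_set :: "'v graph \<Rightarrow> 'v set \<Rightarrow> bool" where
  "perfect_dominating_set G S \<longleftrightarrow>
     S \<subseteq> verts G \<and> (\<forall>v \<in> verts G - S. \<exists>!s. s \<in> S \<and> adjacent G v s)"

definition efficient_dominating_set :: "'v graph \<Rightarrow> 'v set \<Rightarrow> bool" where
  "efficient_dominating_set G S \<longleftrightarrow>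
     S \<subseteq> verts G \<and> (\<forall>v \<in> verts G. card (closed_nbhd G v \<inter> S) = 1)"

text \<open>
  A cycle is represented by the list of its vertices in the order of traversal, from an arbitrary
  starting vertex; indices are read modulo the length.
\<close>

definition cyc :: "'v list \<Rightarrow> nat \<Rightarrow> 'v" where
  "cyc p i = p ! (i mod length p)"

definition cyc_edge :: "'v list \<Rightarrow> nat \<Rightarrow> 'v set" where
  "cyc_edge p i = {cyc p i, cyc p (Suc i)}"

definition cyc_edges :: "'v list \<Rightarrow> 'v set set" where
  "cyc_edges p = cyc_edge p ` {..<length p}"

definition is_cycle :: "'v graph \<Rightarrow> 'v list \<Rightarrow> bool" where
  "is_cycle G p \<longleftrightarrow>
     3 \<le> length p \<and> distinct p \<and> set p \<subseteq> verts G \<and> cyc_edges p \<subseteq> edges G"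


section \<open>Efficient total colorings\<close>

text \<open>A coloring of vertices and edges is a function on the disjoint sum:
  \<open>Inl v\<close> is the vertex \<open>v\<close> and \<open>Inr e\<close> is the edge \<open>e\<close>.\<close>

type_synonym 'v coloring = "'v + 'v set \<Rightarrow> nat"

definition total_coloring :: "'v graph \<Rightarrow> nat set \<Rightarrow> 'v coloring \<Rightarrow> bool" where
  "total_coloring G K \<mu> \<longleftrightarrow>
     \<mu> ` (verts G <+> edges G) \<subseteq> K \<and>
     (\<forall>u v. adjacent G u v \<longrightarrow> \<mu> (Inl u) \<noteq> \<mu> (Inl v)) \<and>
     (\<forall>e \<in> edges G. \<forall>e' \<in> edges G. e \<noteq> e' \<and> e \<inter> e' \<noteq> {} \<longrightarrow> \<mu> (Inr e) \<noteq> \<mu> (Inr e')) \<and>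
     (\<forall>e \<in> edges G. \<forall>v \<in> e. \<mu> (Inl v) \<noteq> \<mu> (Inr e))"

definition vertex_class :: "'v graph \<Rightarrow> 'v coloring \<Rightarrow> nat \<Rightarrow> 'v set" where
  "vertex_class G \<mu> k = {v \<in> verts G. \<mu> (Inl v) = k}"

definition ETC :: "'v graph \<Rightarrow> 'v coloring \<Rightarrow> bool" where
  "ETC G \<mu> \<longleftrightarrow>
     total_coloring G {0..3} \<mu> \<and>
     (\<forall>v \<in> verts G. bij_betw (\<lambda>u. \<mu> (Inl u)) (closed_nbhd G v) {0..3}) \<and>
     partition_on (verts G) (vertex_class G \<mu> ` {0..3}) \<and>
     (\<forall>k \<in> {0..3}. efficient_dominating_set G (vertex_class G \<mu> k))"

definition ETGC :: "'v graph \<Rightarrow> 'v coloring \<Rightarrow> bool" where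
  "ETGC G \<mu> \<longleftrightarrow>
     ETC G \<mu> \<and>
     (\<forall>p. is_cycle G p \<and> length p = 4 \<longrightarrow>
        bij_betw (\<lambda>v. \<mu> (Inl v)) (set p) {0..3} \<and>
        bij_betw (\<lambda>e. \<mu> (Inr e)) (cyc_edges p) {0..3})"


section \<open>The integer lattice graph and the planar maps of its subgraphs\<close>

type_synonym lattice_point = "int \<times> int"

definition embed :: "lattice_point \<Rightarrow> real \<times> real" where
  "embed v = (of_int (fst v), of_int (snd v))"

text \<open>The metric on \<^typ>\<open>real \<times> real\<close> is the Euclidean one.\<close>

definition lattice_graph :: "lattice_point graph" where
  "lattice_graph = (UNIV, {{u, v} | u v. dist (embed u) (embed v) = 1})"

definition edge_segment :: "lattice_point set \<Rightarrow> (real \<times> real) set" where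
  "edge_segment e = convex hull (embed ` e)"

definition drawing :: "lattice_point graph \<Rightarrow> (real \<times> real) set" where
  "drawing G = embed ` verts G \<union> (\<Union>e \<in> edges G. edge_segment e)"

definition faces :: "lattice_point graph \<Rightarrow> (real \<times> real) set set" where
  "faces G = components (- drawing G)"

text \<open>\<open>p\<close> is a traversal, in either direction, of the belt of the face \<open>F\<close>.\<close>

definition belt :: "lattice_point graph \<Rightarrow> (real \<times> real) set \<Rightarrow> lattice_point list \<Rightarrow> bool" where
  "belt G F p \<longleftrightarrow>
     F \<in> faces G \<and> is_cycle G p \<and> frontier F = (\<Union>e \<in> cyc_edges p. edge_segment e)"

text \<open>A face may be homeomorphic to an open disk without being bounded by a cycle (an infinite
  strip, for instance), so both properties are required.\<close>

definition planar_map :: "lattice_point graph \<Rightarrow> bool" where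
  "planar_map G \<longleftrightarrow>
     (\<forall>F \<in> faces G. F homeomorphic ball (0 :: real \<times> real) 1 \<and> (\<exists>p. belt G F p))"

text \<open>A belt is traversed clockwise if its face lies immediately to the right of every edge;
  \<open>right_normal w\<close> is \<open>w\<close> turned to the right by a right angle.\<close>

definition right_normal :: "real \<times> real \<Rightarrow> real \<times> real" where
  "right_normal w = (snd w, - fst w)"

definition on_right :: "(real \<times> real) set \<Rightarrow> real \<times> real \<Rightarrow> real \<times> real \<Rightarrow> bool" where
  "on_right F a b \<longleftrightarrow>
     (\<forall>\<^sub>F t in at_right 0. midpoint a b + t *\<^sub>R right_normal (b - a) \<in> F)"

definition clockwise_belt ::
    "lattice_point graph \<Rightarrow> (real \<times> real) set \<Rightarrow> lattice_point list \<Rightarrow> bool" where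
  "clockwise_belt G F p \<longleftrightarrow>
     belt G F p \<and> (\<forall>i < length p. on_right F (embed (cyc p i)) (embed (cyc p (Suc i))))"

definition adjacent_faces ::
    "lattice_point graph \<Rightarrow> (real \<times> real) set \<Rightarrow> (real \<times> real) set \<Rightarrow> bool" where
  "adjacent_faces G F F' \<longleftrightarrow>
     F \<in> faces G \<and> F' \<in> faces G \<and> F \<noteq> F' \<and>
     (\<exists>e \<in> edges G. edge_segment e \<subseteq> frontier F \<inter> frontier F')"


section \<open>Directed, reversed and periodic colorings\<close>

text \<open>Every color-0 edge of the cycle is reached, in the direction of traversal, from a color-0
  vertex \<open>cyc p j\<close> by passing one further edge: its nearer end is \<open>cyc p (j + 1)\<close>.\<close>

definition directed_along :: "'v coloring \<Rightarrow> 'v list \<Rightarrow> bool" where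
  "directed_along \<mu> p \<longleftrightarrow>
     (\<forall>e \<in> cyc_edges p. \<mu> (Inr e) = 0 \<longrightarrow>
        (\<exists>j < length p. \<mu> (Inl (cyc p j)) = 0 \<and> e = cyc_edge p (j + 1)))"

definition DETGC :: "lattice_point graph \<Rightarrow> lattice_point coloring \<Rightarrow> bool" where
  "DETGC G \<mu> \<longleftrightarrow>
     ETGC G \<mu> \<and> (\<forall>F p. clockwise_belt G F p \<longrightarrow> directed_along \<mu> p)"

definition RETGC :: "lattice_point graph \<Rightarrow> lattice_point coloring \<Rightarrow> bool" where
  "RETGC G \<mu> \<longleftrightarrow>
     ETGC G \<mu> \<and> (\<forall>F p. clockwise_belt G F p \<longrightarrow> directed_along \<mu> (rev p))"

definition color_sequence :: "'v coloring \<Rightarrow> 'v list \<Rightarrow> nat list" where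
  "color_sequence \<mu> p =
     concat (map (\<lambda>i. [\<mu> (Inl (cyc p i)), \<mu> (Inr (cyc_edge p i))]) [0..<length p])"

definition periodic :: "lattice_point graph \<Rightarrow> lattice_point coloring \<Rightarrow> bool" where
  "periodic G \<mu> \<longleftrightarrow>
     (\<forall>F p. belt G F p \<longrightarrow>
        (\<exists>q \<in> {p, rev p}. \<exists>k a b c d m.
           {a, b, c, d} = {0..3} \<and>
           color_sequence \<mu> (rotate k q) = concat (replicate m [a, b, c, a, d, c, b, d])))"

text \<open>
  \<open>\<phi>\<close> is the face coloring corresponding to the periodic coloring \<open>\<mu>\<close>, and it is proper. A
  permutation \<open>abc\<close> of \<open>{1, 2, 3}\<close> is a list. The value at a face must agree with every clockwise
  traversal of its belt that starts at a color-0 vertex, and such a traversal must exist.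
\<close>

definition corresponding_PFC ::
    "lattice_point graph \<Rightarrow> lattice_point coloring \<Rightarrow> ((real \<times> real) set \<Rightarrow> nat list) \<Rightarrow> bool"
where
  "corresponding_PFC G \<mu> \<phi> \<longleftrightarrow>
     periodic G \<mu> \<and>
     (\<forall>F \<in> faces G.
        \<phi> F \<in> permutations_of_set {1, 2, 3} \<and>
        (\<exists>p. clockwise_belt G F p \<and> \<mu> (Inl (cyc p 0)) = 0) \<and>
        (\<forall>p. clockwise_belt G F p \<and> \<mu> (Inl (cyc p 0)) = 0 \<longrightarrow>
           \<phi> F = [\<mu> (Inl (cyc p 1)), \<mu> (Inl (cyc p 2)), \<mu> (Inl (cyc p 3))])) \<and>
     (\<forall>F F'. adjacent_faces G F F' \<longrightarrow> \<phi> F \<noteq> \<phi> F')"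


section \<open>The two forms of the hypothesis\<close>

text \<open>
  For a perfect dominating set of the lattice graph, a finite component is an \<open>r \<times> s\<close> grid and the
  belt around it has length \<open>2 * (r + s) + 4\<close>. So odd components give belts of length divisible by 4,
  but so do components with \<open>r\<close> and \<open>s\<close> both even: the first form below is the more general one.
\<close>

definition belts_divisible_by_4 :: "lattice_point graph \<Rightarrow> bool" where
  "belts_divisible_by_4 G \<longleftrightarrow> planar_map G \<and> (\<forall>F p. belt G F p \<longrightarrow> 4 dvd length p)"

text \<open>Infinite components are excluded as well, since \<^const>\<open>card\<close> is 0 on infinite sets.\<close>

definition odd_components :: "'v graph \<Rightarrow> 'v set \<Rightarrow> bool" where
  "odd_components G S \<longleftrightarrow> (\<forall>C \<in> graph_components (induced_subgraph G S). odd (card C))"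

end

theory Submission
  imports Defs
begin

text \<open>
  Let \<open>\<Lambda>\<close> be the complement of the perfect dominating set, a cubic bipartite plane graph. The four
  colors are regarded as the elements of the Klein four-group. If \<open>c\<close> is a vertex coloring in which
  every closed neighborhood carries all four colors and any four consecutive vertices of a belt have
  distinct colors, then \<open>\<delta>(uv) = c(u) + c(v)\<close> is a proper edge coloring by the three nonzero
  elements, and only two of them occur, alternately, along each belt. Coloring each face by the
  third one gives a proper face coloring \<open>h\<close>, and \<open>\<delta>(e)\<close> is the sum of the colors of the two faces
  at \<open>e\<close>. The proof goes the opposite way: first \<open>h\<close> is constructed, then \<open>\<delta>\<close> is defined by \<open>h\<close>, and
  \<open>c\<close> is obtained by integrating \<open>\<delta>\<close>.

  Both steps use that the plane is simply connected, in the form of \<open>integrate_plane\<close>: transitions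
  between neighboring points of the square lattice that commute around every unit square come from a
  global function. Let \<open>h\<close> be a function of the unit squares which changes only across edges of \<open>\<Lambda>\<close>,
  by a cyclic shift of the three nonzero colors that is counterclockwise around the even vertices and
  clockwise around the odd ones. These transitions commute because each lattice point is on three
  edges of \<open>\<Lambda>\<close> or on none (\<open>face_coloring_exists\<close>). A face is connected, so \<open>h\<close> is constant on it
  (\<open>cell_function_constant_on_face\<close>). The sum of \<open>\<delta>\<close> along a belt of length \<open>4k\<close> around a face of
  color \<open>X\<close>, with edge colors alternating between \<open>Y\<close> and \<open>Z\<close>, is \<open>2kY + 2kZ = 0\<close>. So \<open>\<delta>\<close> extends to
  the lattice edges inside the face with sum zero around each unit square, and \<open>c\<close> exists
  (\<open>vertex_coloring_exists\<close>).

  An edge \<open>uv\<close> gets the color \<open>c(u) + h(F)\<close>, where \<open>F\<close> is the face on the left of \<open>uv\<close> for the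
  directed coloring and the face on the right for the reversed one; either choice is symmetric in \<open>u\<close>
  and \<open>v\<close>, and it makes the color of every belt edge equal to the color of the vertex one step before
  it, in the clockwise or in the counterclockwise direction (\<open>clockwise_edge_colors\<close>). The four colors
  of four consecutive vertices of a belt then determine the periodic pattern. In the permutation
  belonging to a face, the middle entry is the color of that face under \<open>h\<close>, so adjacent faces get
  distinct permutations.

  It remains to see that every face has a belt of length divisible by 4. This is one of the two
  hypotheses. If instead all components of the dominating set are finite and odd, then each of them
  is an \<open>r \<times> s\<close> grid with \<open>r\<close> and \<open>s\<close> odd (\<open>finite_component_rectangle\<close>), the face that contains it
  is an open rectangle whose belt has length \<open>2(r + s) + 4\<close>, and the other faces are open unit squares
  (\<open>rectangular_face\<close>).
\<close>

section \<open>The Klein four-group\<close>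

text \<open>The four colors, with the group structure of the Klein four-group.\<close>

datatype klein = K0 | K1 | K2 | K3

instantiation klein :: ab_group_add
begin

definition zero_klein :: klein where "zero_klein = K0"

fun plus_klein :: "klein \<Rightarrow> klein \<Rightarrow> klein" where
  "plus_klein K0 y = y"
| "plus_klein K1 y = (case y of K0 \<Rightarrow> K1 | K1 \<Rightarrow> K0 | K2 \<Rightarrow> K3 | K3 \<Rightarrow> K2)"
| "plus_klein K2 y = (case y of K0 \<Rightarrow> K2 | K1 \<Rightarrow> K3 | K2 \<Rightarrow> K0 | K3 \<Rightarrow> K1)"
| "plus_klein K3 y = (case y of K0 \<Rightarrow> K3 | K1 \<Rightarrow> K2 | K2 \<Rightarrow> K1 | K3 \<Rightarrow> K0)"

definition uminus_klein :: "klein \<Rightarrow> klein" where "uminus_klein x = x"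

definition minus_klein :: "klein \<Rightarrow> klein \<Rightarrow> klein" where "minus_klein x y = x + y"

instance
proof
  fix a b c :: klein
  show "a + b + c = a + (b + c)" by (cases a; cases b; cases c; simp)
  show "a + b = b + a" by (cases a; cases b; simp)
  show "0 + a = a" by (simp add: zero_klein_def)
  show "- a + a = 0" by (cases a; simp add: zero_klein_def uminus_klein_def)
  show "a - b = a + - b" by (simp add: minus_klein_def uminus_klein_def)
qed

end

lemma klein_add_self [simp]: "x + x = (0::klein)"
  by (cases x; simp add: zero_klein_def)

lemma klein_add_self_left [simp]: "x + (x + y) = (y::klein)"
  by (simp flip: add.assoc)

lemma klein_add_eq_0_iff [simp]: "x + y = 0 \<longleftrightarrow> x = (y::klein)"
  by (cases x; cases y; simp add: zero_klein_def)

lemma UNIV_klein: "UNIV = {K0, K1, K2, K3}"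
  by (auto intro: klein.exhaust)

text \<open>The fourth element is determined by the other three.\<close>

lemma klein_third:
  assumes "x \<noteq> (0::klein)" "y \<noteq> 0" "z \<noteq> 0" "x \<noteq> y" "x \<noteq> z" "y \<noteq> z"
  shows "z = x + y"
  using assms by (cases x; cases y; cases z; simp add: zero_klein_def)

text \<open>The automorphism of order three that permutes the nonzero elements cyclically.\<close>

primrec rot :: "klein \<Rightarrow> klein" where
  "rot K0 = K0" | "rot K1 = K2" | "rot K2 = K3" | "rot K3 = K1"

lemma rot_rot_rot [simp]: "rot (rot (rot x)) = x"
  by (cases x) simp_all

lemma bij_rot: "bij rot"
  by (rule bijI') (metis rot_rot_rot)+

lemma rot_inject [simp]: "rot x = rot y \<longleftrightarrow> x = y"
  by (metis rot_rot_rot)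

lemma rot_eq_0_iff [simp]: "rot x = 0 \<longleftrightarrow> x = 0"
  by (cases x; simp add: zero_klein_def)

lemma rot_neq:
  assumes "x \<noteq> 0"
  shows "rot x \<noteq> x" "x \<noteq> rot x" "rot (rot x) \<noteq> x" "x \<noteq> rot (rot x)"
  using assms by (cases x; simp add: zero_klein_def)+

lemma rot_add_self: "x + rot x = rot (rot x)"
  by (cases x) (simp_all add: zero_klein_def)

text \<open>The numerical color that an element of the group stands for.\<close>

primrec code :: "klein \<Rightarrow> nat" where
  "code K0 = 0" | "code K1 = 1" | "code K2 = 2" | "code K3 = 3"

lemma code_inject [simp]: "code x = code y \<longleftrightarrow> x = y"
  by (cases x; cases y; simp)

lemma code_eq_0_iff [simp]: "code x = 0 \<longleftrightarrow> x = 0"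
  by (cases x; simp add: zero_klein_def)

lemma atLeastAtMost_0_3: "{0..3::nat} = {0, 1, 2, 3}"
  by auto

lemma range_code: "range code = {0..3}"
  by (auto simp: UNIV_klein atLeastAtMost_0_3)

lemma code_in: "code x \<in> {0..3}"
  using range_code by blast

lemma bij_betw_code:
  assumes "inj_on f A" "card A = 4"
  shows "bij_betw (\<lambda>x. code (f x)) A {0..3}"
proof -
  have inj: "inj_on (\<lambda>x. code (f x)) A"
    using assms(1) by (auto simp: inj_on_def)
  moreover have "(\<lambda>x. code (f x)) ` A = {0..3}"
  proof (rule card_subset_eq)
    show "(\<lambda>x. code (f x)) ` A \<subseteq> {0..3}"
      using code_in by (intro image_subsetI)
    show "card ((\<lambda>x. code (f x)) ` A) = card {0..3::nat}"
      using card_image [OF inj] assms(2) by simp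
  qed simp
  ultimately show ?thesis by (simp add: bij_betw_def)
qed

lemma four_kleins:
  assumes "distinct [a, b, c, d :: klein]"
  shows "{a, b, c, d} = UNIV"
proof (rule card_subset_eq)
  have "card {a, b, c, d} = length [a, b, c, d]"
    using assms distinct_card [of "[a, b, c, d]"] by simp
  then show "card {a, b, c, d} = card (UNIV :: klein set)"
    by (simp add: UNIV_klein)
  show "finite (UNIV :: klein set)" by (simp add: UNIV_klein)
qed simp

section \<open>Integration along the square lattice\<close>

lemma integrate_line:
  fixes T :: "int \<Rightarrow> 'a \<Rightarrow> 'a"
  assumes "\<And>n. bij (T n)"
  shows "\<exists>f. f 0 = s \<and> (\<forall>n. f (n + 1) = T n (f n))"
proof -
  define p where "p = rec_nat s (\<lambda>n. T (int n))"
  define q where "q = rec_nat s (\<lambda>n. inv (T (- int n - 1)))"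
  define f where "f n = (if n \<ge> 0 then p (nat n) else q (nat (- n)))" for n
  have p: "p 0 = s" "p (Suc n) = T (int n) (p n)" for n
    by (simp_all add: p_def)
  have q: "q 0 = s" "q (Suc n) = inv (T (- int n - 1)) (q n)" for n
    by (simp_all add: q_def)
  have step: "f (n + 1) = T n (f n)" for n
  proof (cases "n \<ge> 0")
    case True
    then have "nat (n + 1) = Suc (nat n)" by simp
    then show ?thesis using True by (simp add: f_def p)
  next
    case False
    define m where "m = nat (- n - 1)"
    have n: "n = - int m - 1" using False by (simp add: m_def)
    have "f n = q (Suc m)" using n by (simp add: f_def nat_add_distrib)
    then have "T n (f n) = q m"
      by (simp add: q n bij_is_surj [OF assms] surj_f_inv_f)
    moreover have "f (n + 1) = q m"
      using n by (cases "m = 0") (simp_all add: f_def p q)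
    ultimately show ?thesis by simp
  qed
  have "f 0 = s" by (simp add: f_def p)
  then show ?thesis using step by blast
qed

text \<open>
  The plane is simply connected, so transition maps that commute around every unit square are the
  transitions of a globally defined function.
\<close>

lemma integrate_plane:
  fixes A B :: "int \<Rightarrow> int \<Rightarrow> 'a \<Rightarrow> 'a"
  assumes A: "\<And>x y. bij (A x y)" and B: "\<And>x y. bij (B x y)"
    and comm: "\<And>x y t. B (x + 1) y (A x y t) = A x (y + 1) (B x y t)"
  obtains f where "f (0, 0) = s" "\<And>x y. f (x + 1, y) = A x y (f (x, y))"
    "\<And>x y. f (x, y + 1) = B x y (f (x, y))"
proof -
  obtain g where g: "g 0 = s" "\<And>x. g (x + 1) = A x 0 (g x)"
    using integrate_line [of "\<lambda>x. A x 0" s, OF A] by blast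
  have "\<forall>x. \<exists>f. f 0 = g x \<and> (\<forall>n. f (n + 1) = B x n (f n))"
    by (intro allI integrate_line B)
  then obtain h where h: "\<And>x. h x 0 = g x" "\<And>x y. h x (y + 1) = B x y (h x y)"
    by metis
  have "h (x + 1) y = A x y (h x y)" for x y
  proof (induction y rule: int_induct [where k = 0])
    case base
    then show ?case by (simp only: h(1) g(2))
  next
    case (step1 i)
    then show ?case by (simp only: h(2) comm)
  next
    case (step2 i)
    have "B (x + 1) (i - 1) (h (x + 1) (i - 1)) = h (x + 1) i"
      using h(2) [of "x + 1" "i - 1"] by simp
    also have "\<dots> = A x i (B x (i - 1) (h x (i - 1)))"
      using step2 h(2) [of x "i - 1"] by simp
    also have "\<dots> = B (x + 1) (i - 1) (A x (i - 1) (h x (i - 1)))"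
      using comm [of x "i - 1"] by simp
    finally show ?case
      using B bij_is_inj injD by metis
  qed
  then show thesis
    using that [of "\<lambda>(x, y). h x y"] by (simp only: prod.case h g)
qed

lemma plane_induct:
  assumes "P (0, 0)" "\<And>x y. P (x + 1, y) \<longleftrightarrow> P (x, y)" "\<And>x y. P (x, y + 1) \<longleftrightarrow> P (x, y)"
  shows "P (x :: int, y :: int)"
proof -
  have "P (x, 0)" for x
  proof (induction x rule: int_induct [where k = 0])
    case (step2 i)
    then show ?case using assms(2) [of "i - 1"] by simp
  qed (use assms in auto)
  then show ?thesis
  proof (induction y rule: int_induct [where k = 0])
    case (step2 i)
    then show ?case using assms(3) [of _ "i - 1"] by simp
  qed (use assms in auto)
qed

section \<open>Unit squares and faces of subgraphs of the lattice\<close>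

lemma no_int_strictly_between:
  assumes "real_of_int x < a" "a < of_int x + 1"
  shows "a \<noteq> of_int y"
proof
  assume "a = of_int y"
  then have "real_of_int x < of_int y" "real_of_int y < of_int (x + 1)"
    using assms by simp_all
  then show False unfolding of_int_less_iff by simp
qed

lemma int_sum_squares_eq_1:
  fixes m n :: int
  shows "m\<^sup>2 + n\<^sup>2 = 1 \<longleftrightarrow> (m = 0 \<and> (n = 1 \<or> n = -1)) \<or> (n = 0 \<and> (m = 1 \<or> m = -1))"
proof
  assume eq: "m\<^sup>2 + n\<^sup>2 = 1"
  have "\<bar>k\<bar> \<le> 1" if "k\<^sup>2 \<le> 1" for k :: int
    using that by (simp add: abs_square_le_1)
  moreover have "m\<^sup>2 \<le> 1" "n\<^sup>2 \<le> 1"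
    using eq zero_le_power2 [of m] zero_le_power2 [of n] by linarith+
  ultimately have "\<bar>m\<bar> \<le> 1" "\<bar>n\<bar> \<le> 1" by blast+
  then have "m \<in> {-1, 0, 1}" "n \<in> {-1, 0, 1}" by auto
  then show "(m = 0 \<and> (n = 1 \<or> n = -1)) \<or> (n = 0 \<and> (m = 1 \<or> m = -1))"
    using eq by auto
qed auto

lemma adjacent_lattice_graph:
  "adjacent lattice_graph (x, y) (x', y') \<longleftrightarrow>
     (x', y') \<in> {(x + 1, y), (x, y + 1), (x - 1, y), (x, y - 1)}"
proof -
  have "adjacent lattice_graph (x, y) (x', y') \<longleftrightarrow> dist (embed (x, y)) (embed (x', y')) = 1"
    by (auto simp: adjacent_def lattice_graph_def doubleton_eq_iff dist_commute)
  also have "\<dots> \<longleftrightarrow> (real_of_int x - real_of_int x')\<^sup>2 + (real_of_int y - real_of_int y')\<^sup>2 = 1"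
    by (simp add: embed_def dist_Pair_Pair dist_real_def)
  also have "\<dots> \<longleftrightarrow> real_of_int ((x - x')\<^sup>2 + (y - y')\<^sup>2) = real_of_int 1"
    by simp
  also have "\<dots> \<longleftrightarrow> (x - x')\<^sup>2 + (y - y')\<^sup>2 = 1"
    by (rule of_int_eq_iff)
  also have "\<dots> \<longleftrightarrow> (x', y') \<in> {(x + 1, y), (x, y + 1), (x - 1, y), (x, y - 1)}"
    unfolding int_sum_squares_eq_1 by auto
  finally show ?thesis .
qed

lemma adjacent_sym: "adjacent G u v \<longleftrightarrow> adjacent G v u"
  by (simp add: adjacent_def insert_commute)

lemma adjacent_lattice_cases:
  assumes "adjacent lattice_graph u v"
  obtains (east) x y where "u = (x, y)" "v = (x + 1, y)"
  | (north) x y where "u = (x, y)" "v = (x, y + 1)"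
  | (west) x y where "u = (x, y)" "v = (x - 1, y)"
  | (south) x y where "u = (x, y)" "v = (x, y - 1)"
  using assms by (cases u; cases v) (auto simp: adjacent_lattice_graph)

text \<open>A unit square is represented by its lower left corner; this is the one on the left of the
  step from \<open>u\<close> to the adjacent point \<open>v\<close>. The one on the right is \<open>left_cell v u\<close>.\<close>

definition left_cell :: "lattice_point \<Rightarrow> lattice_point \<Rightarrow> lattice_point" where
  "left_cell u v =
     ((fst u + fst v - (snd v - snd u) - 1) div 2, (snd u + snd v + (fst v - fst u) - 1) div 2)"

lemma left_cell_simps [simp]:
  "left_cell (x, y) (x + 1, y) = (x, y)"
  "left_cell (x, y) (x, y + 1) = (x - 1, y)"
  "left_cell (x, y) (x - 1, y) = (x - 1, y - 1)"
  "left_cell (x, y) (x, y - 1) = (x, y - 1)"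
  "left_cell (x + 1, y) (x, y) = (x, y - 1)"
  "left_cell (x, y + 1) (x, y) = (x, y)"
  "left_cell (x - 1, y) (x, y) = (x - 1, y)"
  "left_cell (x, y - 1) (x, y) = (x - 1, y - 1)"
  unfolding left_cell_def by auto

text \<open>The interior, the closure and the midpoint of the unit square with a given lower left corner.\<close>

definition open_cell :: "lattice_point \<Rightarrow> (real \<times> real) set" where
  "open_cell K = {of_int (fst K)<..<of_int (fst K) + 1} \<times> {of_int (snd K)<..<of_int (snd K) + 1}"

definition closed_cell :: "lattice_point \<Rightarrow> (real \<times> real) set" where
  "closed_cell K = {of_int (fst K)..of_int (fst K) + 1} \<times> {of_int (snd K)..of_int (snd K) + 1}"

definition center :: "lattice_point \<Rightarrow> real \<times> real" where
  "center K = (of_int (fst K) + 1/2, of_int (snd K) + 1/2)"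

lemma mem_open_cell:
  "(a, b) \<in> open_cell (x, y) \<longleftrightarrow>
     of_int x < a \<and> a < of_int x + 1 \<and> of_int y < b \<and> b < of_int y + 1"
  by (auto simp: open_cell_def)

lemma mem_closed_cell:
  "(a, b) \<in> closed_cell (x, y) \<longleftrightarrow>
     of_int x \<le> a \<and> a \<le> of_int x + 1 \<and> of_int y \<le> b \<and> b \<le> of_int y + 1"
  by (auto simp: closed_cell_def)

lemma center_in_open_cell: "center K \<in> open_cell K"
  by (simp add: center_def open_cell_def)

lemma open_cell_subset_closed_cell: "open_cell K \<subseteq> closed_cell K"
  by (auto simp: open_cell_def closed_cell_def)

lemma closure_open_cell: "closure (open_cell K) = closed_cell K"
  by (simp add: open_cell_def closed_cell_def closure_Times)

lemma closed_closed_cell: "closed (closed_cell K)"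
  by (simp add: closed_cell_def closed_Times)

lemma connected_open_cell: "connected (open_cell K)"
  unfolding open_cell_def by (intro connected_Times connected_Ioo)

lemma in_some_closed_cell: "\<exists>K. z \<in> closed_cell K"
proof -
  obtain a b where z: "z = (a, b)" by (cases z)
  have "(a, b) \<in> closed_cell (\<lfloor>a\<rfloor>, \<lfloor>b\<rfloor>)"
    unfolding mem_closed_cell by linarith
  then show ?thesis using z by blast
qed

lemma closed_Union_closed_cells: "closed (\<Union>K\<in>A. closed_cell K)"
proof -
  have "closedin euclidean (\<Union>(closed_cell ` A))"
  proof (rule closedin_locally_finite_Union)
    show "closedin euclidean C" if "C \<in> closed_cell ` A" for C
      using that closed_closed_cell by auto
    show "locally_finite_in euclidean (closed_cell ` A)"
      unfolding locally_finite_in_def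
    proof (intro conjI ballI)
      fix z :: "real \<times> real"
      obtain a b where z: "z = (a, b)" by (cases z)
      define N where "N = {\<lfloor>a\<rfloor> - 3..\<lfloor>a\<rfloor> + 3} \<times> {\<lfloor>b\<rfloor> - 3..\<lfloor>b\<rfloor> + 3}"
      have "K \<in> N" if meets: "closed_cell K \<inter> ball z 1 \<noteq> {}" for K
      proof -
        obtain x y where K: "K = (x, y)" by (cases K)
        obtain a' b' where w: "(a', b') \<in> closed_cell K" "dist z (a', b') < 1"
          using meets by auto
        have "\<bar>a - a'\<bar> < 1" "\<bar>b - b'\<bar> < 1"
          using w(2) dist_fst_le [of z "(a', b')"] dist_snd_le [of z "(a', b')"]
          by (auto simp: z dist_real_def)
        then show ?thesis
          using w(1) unfolding K N_def mem_closed_cell mem_Times_iff fst_conv snd_conv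
            atLeastAtMost_iff by linarith
      qed
      then have "{C \<in> closed_cell ` A. C \<inter> ball z 1 \<noteq> {}} \<subseteq> closed_cell ` N"
        by blast
      moreover have "finite N" by (simp add: N_def)
      ultimately have "finite {C \<in> closed_cell ` A. C \<inter> ball z 1 \<noteq> {}}"
        by (meson finite_imageI finite_subset)
      then show "\<exists>V. openin euclidean V \<and> z \<in> V \<and> finite {U \<in> closed_cell ` A. U \<inter> V \<noteq> {}}"
        by (intro exI [of _ "ball z 1"]) auto
    qed auto
  qed
  then show ?thesis by simp
qed

lemma edge_segment_subset_closed_cell:
  assumes "adjacent lattice_graph u v"
  shows "edge_segment {u, v} \<subseteq> closed_cell (left_cell u v)"
    and "edge_segment {u, v} \<subseteq> closed_cell (left_cell v u)"
proof -
  have conv: "convex (closed_cell K)" for K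
    unfolding closed_cell_def by (intro convex_Times) auto
  have "embed ` {u, v} \<subseteq> closed_cell (left_cell u v) \<inter> closed_cell (left_cell v u)"
    using assms by (cases rule: adjacent_lattice_cases) (auto simp: embed_def closed_cell_def)
  then show "edge_segment {u, v} \<subseteq> closed_cell (left_cell u v)"
    "edge_segment {u, v} \<subseteq> closed_cell (left_cell v u)"
    unfolding edge_segment_def by (meson hull_minimal conv Int_subset_iff)+
qed

lemma edge_segment_horizontal:
  "edge_segment {(x, y), (x + 1, y)} = {of_int x..of_int x + 1} \<times> {of_int y}"
proof -
  have "edge_segment {(x, y), (x + 1, y)} =
      closed_segment (of_int x, of_int y) (of_int x + 1, of_int y)"
    by (simp add: edge_segment_def segment_convex_hull embed_def)
  also have "\<dots> = {of_int x..of_int x + 1} \<times> {of_int y}"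
  proof (intro set_eqI iffI)
    fix z :: "real \<times> real"
    assume "z \<in> closed_segment (of_int x, of_int y) (of_int x + 1, of_int y)"
    then show "z \<in> {of_int x..of_int x + 1} \<times> {of_int y}"
      by (auto simp: closed_segment_def algebra_simps)
  next
    fix z :: "real \<times> real"
    assume "z \<in> {of_int x..of_int x + 1} \<times> {of_int y}"
    then show "z \<in> closed_segment (of_int x, of_int y) (of_int x + 1, of_int y)"
      unfolding closed_segment_def
      by (intro CollectI exI [of _ "fst z - of_int x"]) (auto simp: algebra_simps)
  qed
  finally show ?thesis .
qed

lemma edge_segment_vertical:
  "edge_segment {(x, y), (x, y + 1)} = {of_int x} \<times> {of_int y..of_int y + 1}"
proof -
  have "edge_segment {(x, y), (x, y + 1)} =
      closed_segment (of_int x, of_int y) (of_int x, of_int y + 1)"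
    by (simp add: edge_segment_def segment_convex_hull embed_def)
  also have "\<dots> = {of_int x} \<times> {of_int y..of_int y + 1}"
  proof (intro set_eqI iffI)
    fix z :: "real \<times> real"
    assume "z \<in> closed_segment (of_int x, of_int y) (of_int x, of_int y + 1)"
    then show "z \<in> {of_int x} \<times> {of_int y..of_int y + 1}"
      by (auto simp: closed_segment_def algebra_simps)
  next
    fix z :: "real \<times> real"
    assume "z \<in> {of_int x} \<times> {of_int y..of_int y + 1}"
    then show "z \<in> closed_segment (of_int x, of_int y) (of_int x, of_int y + 1)"
      unfolding closed_segment_def
      by (intro CollectI exI [of _ "snd z - of_int y"]) (auto simp: algebra_simps)
  qed
  finally show ?thesis .
qed

text \<open>The subgraph \<open>L\<close> of the lattice that is left after deleting an arbitrary set \<open>S\<close> of points.\<close>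

locale lattice_subgraph =
  fixes S :: "lattice_point set" and L :: "lattice_point graph"
  assumes L_eq: "L = delete_vertices lattice_graph S"
begin

lemma verts_L: "verts L = - S"
  by (auto simp: L_eq delete_vertices_def induced_subgraph_def lattice_graph_def)

lemma adjacent_L: "adjacent L u v \<longleftrightarrow> adjacent lattice_graph u v \<and> u \<notin> S \<and> v \<notin> S"
  by (auto simp: L_eq delete_vertices_def induced_subgraph_def lattice_graph_def adjacent_def)

lemma edges_L_E:
  assumes "e \<in> edges L"
  obtains u v where "e = {u, v}" "adjacent L u v"
proof -
  from assms obtain u v where "e = {u, v}"
    by (auto simp: L_eq delete_vertices_def induced_subgraph_def lattice_graph_def)
  then show thesis using assms that by (auto simp: adjacent_def)
qed

lemma edges_L_cases:
  assumes "e \<in> edges L"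
  obtains (horizontal) x y where "e = {(x, y), (x + 1, y)}" "(x, y) \<notin> S" "(x + 1, y) \<notin> S"
  | (vertical) x y where "e = {(x, y), (x, y + 1)}" "(x, y) \<notin> S" "(x, y + 1) \<notin> S"
proof -
  obtain u v where e: "e = {u, v}" "adjacent L u v"
    using assms by (rule edges_L_E)
  then have "adjacent lattice_graph u v" "u \<notin> S" "v \<notin> S"
    by (simp_all add: adjacent_L)
  then show thesis
  proof (cases rule: adjacent_lattice_cases)
    case (east x y)
    then show ?thesis using horizontal e \<open>u \<notin> S\<close> \<open>v \<notin> S\<close> by simp
  next
    case (north x y)
    then show ?thesis using vertical e \<open>u \<notin> S\<close> \<open>v \<notin> S\<close> by simp
  next
    case (west x y)
    then show ?thesis using horizontal [of "x - 1" y] e \<open>u \<notin> S\<close> \<open>v \<notin> S\<close>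
      by (simp add: insert_commute)
  next
    case (south x y)
    then show ?thesis using vertical [of x "y - 1"] e \<open>u \<notin> S\<close> \<open>v \<notin> S\<close>
      by (simp add: insert_commute)
  qed
qed

lemma drawing_cases:
  assumes "(a, b) \<in> drawing L"
  obtains (vertex) x y where "a = of_int x" "b = of_int y" "(x, y) \<notin> S"
  | (horizontal) x y where "of_int x \<le> a" "a \<le> of_int x + 1" "b = of_int y"
      "(x, y) \<notin> S" "(x + 1, y) \<notin> S"
  | (vertical) x y where "of_int y \<le> b" "b \<le> of_int y + 1" "a = of_int x"
      "(x, y) \<notin> S" "(x, y + 1) \<notin> S"
proof -
  from assms consider v where "v \<in> verts L" "(a, b) = embed v"
    | e where "e \<in> edges L" "(a, b) \<in> edge_segment e"
    by (auto simp: drawing_def)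
  then show thesis
  proof cases
    case 1
    then show ?thesis
      using vertex [of "fst v" "snd v"] by (simp add: embed_def verts_L)
  next
    case 2
    from 2(1) show ?thesis
    proof (cases rule: edges_L_cases)
      case h: (horizontal x y)
      then show ?thesis
        using 2(2) horizontal [of x y] unfolding h(1) edge_segment_horizontal by auto
    next
      case v: (vertical x y)
      then show ?thesis
        using 2(2) vertical [of y x] unfolding v(1) edge_segment_vertical by auto
    qed
  qed
qed

lemma edge_segment_subset_drawing:
  assumes "adjacent L u v"
  shows "edge_segment {u, v} \<subseteq> drawing L"
  using assms by (auto simp: adjacent_def drawing_def)

lemma open_cell_disjoint_drawing: "open_cell K \<inter> drawing L = {}"
proof -
  have False if z: "z \<in> open_cell K" "z \<in> drawing L" for z
  proof -
    obtain a b x y where eq: "z = (a, b)" "K = (x, y)" by (cases z; cases K)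
    have cell: "of_int x < a" "a < of_int x + 1" "of_int y < b" "b < of_int y + 1"
      using z(1) by (simp_all add: eq mem_open_cell)
    have "(a, b) \<in> drawing L" using z(2) eq by simp
    then show False
    proof (cases rule: drawing_cases)
      case (vertex x' y')
      then show ?thesis using cell no_int_strictly_between by blast
    next
      case (horizontal x' y')
      then show ?thesis using cell no_int_strictly_between by blast
    next
      case (vertical y' x')
      then show ?thesis using cell no_int_strictly_between by blast
    qed
  qed
  then show ?thesis by blast
qed

text \<open>The face that contains the interior of a given unit square.\<close>

definition face :: "lattice_point \<Rightarrow> (real \<times> real) set" where
  "face K = connected_component_set (- drawing L) (center K)"

lemma face_in_faces: "face K \<in> faces L"
proof -
  have "center K \<in> - drawing L"
    using center_in_open_cell open_cell_disjoint_drawing by blast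
  then show ?thesis
    unfolding faces_def face_def components_def by blast
qed

text \<open>The points of a closed square off the drawing lie in the face that contains its interior.\<close>

lemma mem_face:
  assumes "z \<in> closed_cell K" "z \<notin> drawing L"
  shows "z \<in> face K"
proof -
  have "connected (insert z (open_cell K))"
    using connected_open_cell
    by (rule connected_intermediate_closure)
       (use assms(1) closure_subset [of "open_cell K"] in \<open>auto simp: closure_open_cell\<close>)
  moreover have "insert z (open_cell K) \<subseteq> - drawing L"
    using assms(2) open_cell_disjoint_drawing by blast
  ultimately have "insert z (open_cell K) \<subseteq> face K"
    unfolding face_def using center_in_open_cell by (intro connected_component_maximal) auto
  then show ?thesis by simp
qed

lemma open_cell_subset_face: "open_cell K \<subseteq> face K"
  using mem_face open_cell_disjoint_drawing open_cell_subset_closed_cell by blast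

lemma face_disjoint_drawing:
  assumes "F \<in> faces L"
  shows "F \<inter> drawing L = {}"
  using assms in_components_subset unfolding faces_def by blast

lemma faces_eqI:
  assumes "F \<in> faces L" "F' \<in> faces L" "z \<in> F" "z \<in> F'"
  shows "F = F'"
  using assms components_nonoverlap unfolding faces_def by blast

lemma face_eqI:
  assumes "F \<in> faces L" "z \<in> F" "z \<in> closed_cell K"
  shows "F = face K"
  using assms faces_eqI face_in_faces mem_face face_disjoint_drawing by blast

lemma faces_E:
  assumes "F \<in> faces L"
  obtains K where "F = face K"
proof -
  obtain z where "z \<in> F"
    using assms in_components_nonempty unfolding faces_def by blast
  then show thesis
    using that in_some_closed_cell face_eqI assms by metis
qed

lemma horizontal_midpoint_in_drawing:
  assumes "(of_int x + 1/2, of_int y) \<in> drawing L"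
  shows "(x, y) \<notin> S \<and> (x + 1, y) \<notin> S"
  using assms
proof (cases rule: drawing_cases)
  case (vertex x' y')
  then show ?thesis using no_int_strictly_between [of x "of_int x + 1/2" x'] by simp
next
  case (horizontal x' y')
  then have "x' = x" "y' = y" by linarith+
  with horizontal show ?thesis by simp
next
  case (vertical x' y')
  then show ?thesis using no_int_strictly_between [of x "of_int x + 1/2" x'] by simp
qed

lemma vertical_midpoint_in_drawing:
  assumes "(of_int x, of_int y + 1/2) \<in> drawing L"
  shows "(x, y) \<notin> S \<and> (x, y + 1) \<notin> S"
  using assms
proof (cases rule: drawing_cases)
  case (vertex x' y')
  then show ?thesis using no_int_strictly_between [of y "of_int y + 1/2" y'] by simp
next
  case (horizontal x' y')
  then show ?thesis using no_int_strictly_between [of y "of_int y + 1/2" y'] by simp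
next
  case (vertical x' y')
  then have "x' = x" "y' = y" by linarith+
  with vertical show ?thesis by simp
qed

text \<open>Squares that are separated by no edge of the subgraph lie in the same face.\<close>

lemma face_eq_if_not_edge:
  assumes uv: "adjacent lattice_graph u v" and nonedge: "\<not> adjacent L u v"
  shows "face (left_cell u v) = face (left_cell v u)"
proof -
  have ends: "\<not> (u \<notin> S \<and> v \<notin> S)"
    using uv nonedge by (simp add: adjacent_L)
  have "midpoint (embed u) (embed v) \<notin> drawing L"
    using uv
  proof (cases rule: adjacent_lattice_cases)
    case (east x y)
    then have "midpoint (embed u) (embed v) = (of_int x + 1/2, of_int y)"
      by (simp add: midpoint_def embed_def field_simps)
    then show ?thesis using horizontal_midpoint_in_drawing [of x y] ends east by auto
  next
    case (north x y)
    then have "midpoint (embed u) (embed v) = (of_int x, of_int y + 1/2)"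
      by (simp add: midpoint_def embed_def field_simps)
    then show ?thesis using vertical_midpoint_in_drawing [of x y] ends north by auto
  next
    case (west x y)
    then have "midpoint (embed u) (embed v) = (of_int (x - 1) + 1/2, of_int y)"
      by (simp add: midpoint_def embed_def field_simps)
    then show ?thesis using horizontal_midpoint_in_drawing [of "x - 1" y] ends west by auto
  next
    case (south x y)
    then have "midpoint (embed u) (embed v) = (of_int x, of_int (y - 1) + 1/2)"
      by (simp add: midpoint_def embed_def field_simps)
    then show ?thesis using vertical_midpoint_in_drawing [of x "y - 1"] ends south by auto
  qed
  moreover have "midpoint (embed u) (embed v) \<in> edge_segment {u, v}"
    by (simp add: edge_segment_def flip: segment_convex_hull)
  ultimately show ?thesis
    using edge_segment_subset_closed_cell [OF uv] mem_face face_eqI face_in_faces by (metis subsetD)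
qed

lemma edge_segment_subset_frontier:
  assumes "adjacent L u v"
  shows "edge_segment {u, v} \<subseteq> frontier (face (left_cell u v))"
    and "edge_segment {u, v} \<subseteq> frontier (face (left_cell v u))"
proof -
  have *: "edge_segment {u, v} \<subseteq> frontier (face K)" if "edge_segment {u, v} \<subseteq> closed_cell K" for K
  proof -
    have "closed_cell K \<subseteq> closure (face K)"
      using closure_open_cell closure_mono open_cell_subset_face by metis
    moreover have "edge_segment {u, v} \<inter> face K = {}"
      using edge_segment_subset_drawing [OF assms] face_disjoint_drawing [OF face_in_faces] by blast
    ultimately show ?thesis
      unfolding frontier_def using that interior_subset by blast
  qed
  have "adjacent lattice_graph u v" using assms by (simp add: adjacent_L)
  then show "edge_segment {u, v} \<subseteq> frontier (face (left_cell u v))"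
    "edge_segment {u, v} \<subseteq> frontier (face (left_cell v u))"
    using * edge_segment_subset_closed_cell by blast+
qed

text \<open>Only the two faces beside an edge can have it on their frontier.\<close>

lemma face_if_edge_subset_frontier:
  assumes uv: "adjacent lattice_graph u v" and F: "F \<in> faces L"
    and sub: "edge_segment {u, v} \<subseteq> frontier F"
  shows "F = face (left_cell u v) \<or> F = face (left_cell v u)"
proof -
  have "midpoint (embed u) (embed v) \<in> edge_segment {u, v}"
    by (simp add: edge_segment_def flip: segment_convex_hull)
  then have "midpoint (embed u) (embed v) \<in> closure F"
    using sub by (auto simp: frontier_def)
  then obtain z where z: "z \<in> F" "dist z (midpoint (embed u) (embed v)) < 1/2"
    unfolding closure_approachable by (metis half_gt_zero zero_less_one)
  define m where "m = midpoint (embed u) (embed v)"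
  have "\<bar>fst z - fst m\<bar> < 1/2" "\<bar>snd z - snd m\<bar> < 1/2"
    using z(2) dist_fst_le [of z m] dist_snd_le [of z m] by (auto simp: dist_real_def m_def)
  then have near: "fst m - 1/2 < fst z" "fst z < fst m + 1/2"
      "snd m - 1/2 < snd z" "snd z < snd m + 1/2"
    by linarith+
  obtain a b where ab: "z = (a, b)" by (cases z)
  have "z \<in> closed_cell (left_cell u v) \<or> z \<in> closed_cell (left_cell v u)"
    using uv
  proof (cases rule: adjacent_lattice_cases)
    case (east x y)
    then have "m = (of_int x + 1/2, of_int y)"
      by (simp add: m_def midpoint_def embed_def field_simps)
    then show ?thesis
      using near east by (cases "b \<ge> snd m") (simp_all add: ab mem_closed_cell)
  next
    case (north x y)
    then have "m = (of_int x, of_int y + 1/2)"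
      by (simp add: m_def midpoint_def embed_def field_simps)
    then show ?thesis
      using near north by (cases "a \<ge> fst m") (simp_all add: ab mem_closed_cell)
  next
    case (west x y)
    then have "m = (of_int x - 1/2, of_int y)"
      by (simp add: m_def midpoint_def embed_def field_simps)
    then show ?thesis
      using near west by (cases "b \<ge> snd m") (simp_all add: ab mem_closed_cell)
  next
    case (south x y)
    then have "m = (of_int x, of_int y - 1/2)"
      by (simp add: m_def midpoint_def embed_def field_simps)
    then show ?thesis
      using near south by (cases "a \<ge> fst m") (simp_all add: ab mem_closed_cell)
  qed
  then show ?thesis using face_eqI F z(1) by blast
qed

lemma on_right_iff:
  assumes uv: "adjacent lattice_graph u v" and F: "F \<in> faces L"
  shows "on_right F (embed u) (embed v) \<longleftrightarrow> F = face (left_cell v u)"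
proof -
  define z where "z t = midpoint (embed u) (embed v) + t *\<^sub>R right_normal (embed v - embed u)" for t
  have cell: "z t \<in> open_cell (left_cell v u)" if "0 < t" "t < 1" for t
    using uv that unfolding z_def
    by (cases rule: adjacent_lattice_cases)
       (simp_all add: midpoint_def embed_def mem_open_cell right_normal_def field_simps)
  have ev: "\<forall>\<^sub>F t in at_right 0. (0::real) < t \<and> t < 1"
    by (auto simp: eventually_at_right_field intro: exI [of _ 1])
  show ?thesis
  proof
    assume "on_right F (embed u) (embed v)"
    then have "\<forall>\<^sub>F t in at_right 0. z t \<in> F"
      by (simp add: on_right_def z_def)
    then have "\<forall>\<^sub>F t in at_right 0. z t \<in> F \<and> 0 < t \<and> t < 1"
      using ev by (rule eventually_conj)
    then obtain t where "z t \<in> F" "0 < t" "t < 1"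
      using eventually_happens' [OF trivial_limit_at_right_real] by blast
    then show "F = face (left_cell v u)"
      using cell face_eqI F open_cell_subset_closed_cell by blast
  next
    assume "F = face (left_cell v u)"
    then have "\<forall>\<^sub>F t in at_right 0. z t \<in> F"
      using ev cell subsetD [OF open_cell_subset_face] by (simp add: eventually_mono)
    then show "on_right F (embed u) (embed v)"
      by (simp add: on_right_def z_def)
  qed
qed

text \<open>
  A function of the unit squares that changes only across edges of the subgraph is constant on
  every face: each face is connected, and it is covered by two closed sets, the squares on which the
  function takes a given value and the other squares, which are disjoint off the drawing.
\<close>

lemma cell_function_constant_on_face:
  fixes h :: "lattice_point \<Rightarrow> 'a"
  assumes h: "\<And>u v. adjacent lattice_graph u v \<Longrightarrow> \<not> adjacent L u v \<Longrightarrow>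
      h (left_cell u v) = h (left_cell v u)"
    and eq: "face K = face K'"
  shows "h K = h K'"
proof -
  have vert: "h (x, y) = h (x + 1, y)"
    if "z \<notin> drawing L" "z \<in> closed_cell (x, y)" "z \<in> closed_cell (x + 1, y)" for z x y
  proof -
    obtain a b where z: "z = (a, b)" by (cases z)
    have "z \<in> edge_segment {(x + 1, y), (x + 1, y + 1)}"
      using that by (simp add: z edge_segment_vertical mem_closed_cell)
    then have "\<not> adjacent L (x + 1, y) (x + 1, y + 1)"
      using that(1) edge_segment_subset_drawing by blast
    then show ?thesis
      using h [of "(x + 1, y)" "(x + 1, y + 1)"] by (simp add: adjacent_lattice_graph)
  qed
  have horiz: "h (x, y) = h (x, y + 1)"
    if "z \<notin> drawing L" "z \<in> closed_cell (x, y)" "z \<in> closed_cell (x, y + 1)" for z x y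
  proof -
    obtain a b where z: "z = (a, b)" by (cases z)
    have "z \<in> edge_segment {(x, y + 1), (x + 1, y + 1)}"
      using that by (simp add: z edge_segment_horizontal mem_closed_cell)
    then have "\<not> adjacent L (x, y + 1) (x + 1, y + 1)"
      using that(1) edge_segment_subset_drawing by blast
    then show ?thesis
      using h [of "(x, y + 1)" "(x + 1, y + 1)"] by (simp add: adjacent_lattice_graph)
  qed
  have same: "h K1 = h K2" if z: "z \<notin> drawing L" "z \<in> closed_cell K1" "z \<in> closed_cell K2"
    for z K1 K2
  proof -
    obtain a b x y x' y' where e: "z = (a, b)" "K1 = (x, y)" "K2 = (x', y')"
      by (cases z; cases K1; cases K2)
    have mid: "z \<in> closed_cell (x', y)"
      using z by (simp add: e mem_closed_cell)
    have "x' = x \<or> x' = x + 1 \<or> x = x' + 1"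
      using z unfolding e mem_closed_cell by linarith
    then have "h (x, y) = h (x', y)"
      using vert [of z x y] vert [of z x' y] z mid by (auto simp: e)
    moreover have "y' = y \<or> y' = y + 1 \<or> y = y' + 1"
      using z unfolding e mem_closed_cell by linarith
    then have "h (x', y) = h (x', y')"
      using horiz [of z x' y] horiz [of z x' y'] z mid by (auto simp: e)
    ultimately show ?thesis by (simp add: e)
  qed
  define A where "A = (\<Union>J \<in> {J. h J = h K}. closed_cell J)"
  define B where "B = (\<Union>J \<in> {J. h J \<noteq> h K}. closed_cell J)"
  have "connected (face K)"
    unfolding face_def by (rule connected_connected_component)
  moreover have "closed A" "closed B"
    unfolding A_def B_def by (rule closed_Union_closed_cells)+
  moreover have "face K \<subseteq> A \<union> B"
    using in_some_closed_cell unfolding A_def B_def by blast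
  moreover have "A \<inter> B \<inter> face K = {}"
  proof (intro equals0I)
    fix z assume z: "z \<in> A \<inter> B \<inter> face K"
    then obtain J J' where "z \<in> closed_cell J" "z \<in> closed_cell J'" "h J = h K" "h J' \<noteq> h K"
      by (auto simp: A_def B_def)
    moreover have "z \<notin> drawing L"
      using z face_disjoint_drawing [OF face_in_faces, of K] by blast
    ultimately show False using same [of z J J'] by simp
  qed
  ultimately have "A \<inter> face K = {} \<or> B \<inter> face K = {}"
    unfolding connected_closed by metis
  moreover have "center K \<in> A \<inter> face K"
  proof
    show "center K \<in> A"
      unfolding A_def using subsetD [OF open_cell_subset_closed_cell center_in_open_cell]
      by (intro UN_I [of K]) simp_all
    show "center K \<in> face K"
      using center_in_open_cell open_cell_subset_face by blast
  qed
  ultimately have "B \<inter> face K = {}" by blast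
  moreover have "center K' \<in> face K \<inter> closed_cell K'"
    using center_in_open_cell open_cell_subset_closed_cell open_cell_subset_face eq by blast
  ultimately have "center K' \<notin> B" "center K' \<in> closed_cell K'" by blast+
  then show ?thesis
    unfolding B_def by (metis (mono_tags, lifting) UN_I mem_Collect_eq)
qed

end

section \<open>Cycles and belts\<close>

lemma cyc_mod [simp]: "cyc p (i mod length p) = cyc p i"
  by (simp add: cyc_def)

lemma cyc_add_length [simp]: "cyc p (i + length p) = cyc p i"
  by (simp add: cyc_def)

lemma cyc_add_mult_length [simp]: "cyc p (i + k * length p) = cyc p i"
  by (simp add: cyc_def)

lemma cyc_nth: "i < length p \<Longrightarrow> cyc p i = p ! i"
  by (simp add: cyc_def)

lemma cyc_in_set: "p \<noteq> [] \<Longrightarrow> cyc p i \<in> set p"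
  by (simp add: cyc_def)

lemma set_conv_cyc: "v \<in> set p \<longleftrightarrow> (\<exists>i<length p. v = cyc p i)"
  by (auto simp: in_set_conv_nth cyc_nth)

lemma cyc_Suc_mod: "cyc p (Suc (i mod length p)) = cyc p (Suc i)"
  by (metis cyc_mod mod_Suc_eq)

lemma cyc_edge_mod: "cyc_edge p (i mod length p) = cyc_edge p i"
  by (simp add: cyc_edge_def cyc_Suc_mod)

lemma cyc_edge_in_cyc_edges:
  assumes "p \<noteq> []"
  shows "cyc_edge p i \<in> cyc_edges p"
proof -
  have "cyc_edge p (i mod length p) \<in> cyc_edges p"
    unfolding cyc_edges_def using assms by (intro imageI) simp
  then show ?thesis by (simp add: cyc_edge_mod)
qed

lemma cyc_eq_iff:
  assumes "distinct p" "p \<noteq> []"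
  shows "cyc p i = cyc p j \<longleftrightarrow> i mod length p = j mod length p"
  using assms by (simp add: cyc_def nth_eq_iff_index_eq)

lemma cyc_rev:
  assumes "i < k * length p"
  shows "cyc (rev p) i = cyc p (k * length p - 1 - i)"
proof -
  define n where "n = length p"
  have n: "n > 0" using assms by (cases p) (auto simp: n_def)
  have "i div n < k" using assms by (simp add: n_def less_mult_imp_div_less)
  then obtain l where k: "k = i div n + 1 + l"
    by (metis Suc_eq_plus1 less_iff_Suc_add add.commute add_Suc_right add_Suc)
  have "k * n = (i div n) * n + n + l * n"
    by (simp add: k algebra_simps)
  then have "k * n - 1 - i = (n - 1 - i mod n) + l * n"
    using n mod_less_divisor [OF n, of i] div_mult_mod_eq [of i n] by linarith
  then have "cyc p (k * n - 1 - i) = cyc p (n - 1 - i mod n)"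
    by (simp add: n_def)
  moreover have "cyc (rev p) i = rev p ! (i mod n)"
    by (simp add: cyc_def n_def)
  moreover have "\<dots> = p ! (n - 1 - i mod n)"
    using n by (simp add: rev_nth n_def)
  ultimately show ?thesis
    using n by (simp add: n_def cyc_def)
qed

text \<open>Three consecutive vertices of the reversed traversal are consecutive in the original one.\<close>

lemma cyc_rev_window:
  assumes "p \<noteq> []"
  obtains j where "cyc (rev p) i = cyc p (j + 2)" "cyc (rev p) (i + 1) = cyc p (j + 1)"
    "cyc (rev p) (i + 2) = cyc p j"
proof -
  define k where "k = i + 3"
  define n where "n = length p"
  have "n > 0" using assms by (simp add: n_def)
  then have "i + 3 \<le> k * n"
    unfolding k_def by (metis Suc_leI mult.right_neutral mult_le_mono2 One_nat_def)
  then have "k * n - 1 - i = (k * n - 3 - i) + 2" "k * n - 1 - (i + 1) = (k * n - 3 - i) + 1"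
    "k * n - 1 - (i + 2) = k * n - 3 - i" "i + 2 < k * n"
    by linarith+
  then show thesis
    using that [of "k * n - 3 - i"] cyc_rev [of i k p] cyc_rev [of "i + 1" k p]
      cyc_rev [of "i + 2" k p]
    unfolding n_def by simp
qed

lemma cyc_edges_rev: "cyc_edges (rev p) = cyc_edges p"
proof -
  have sub: "cyc_edges (rev q) \<subseteq> cyc_edges q" for q :: "'a list"
  proof
    fix e assume "e \<in> cyc_edges (rev q)"
    then obtain i where e: "e = cyc_edge (rev q) i" and "i < length q"
      by (auto simp: cyc_edges_def)
    then have "q \<noteq> []" by auto
    from \<open>q \<noteq> []\<close> obtain j where "cyc (rev q) i = cyc q (j + 2)" "cyc (rev q) (i + 1) = cyc q (j + 1)"
      by (rule cyc_rev_window)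
    then have "e = cyc_edge q (j + 1)"
      by (simp add: e cyc_edge_def insert_commute)
    then show "e \<in> cyc_edges q"
      using cyc_edge_in_cyc_edges \<open>q \<noteq> []\<close> by blast
  qed
  from sub [of p] sub [of "rev p"] show ?thesis by simp
qed

lemma is_cycle_rev: "is_cycle G (rev p) \<longleftrightarrow> is_cycle G p"
  by (simp add: is_cycle_def cyc_edges_rev)

lemma belt_rev: "belt G F (rev p) \<longleftrightarrow> belt G F p"
  by (simp add: belt_def cyc_edges_rev is_cycle_rev)

lemma cyc_rotate:
  assumes "p \<noteq> []"
  shows "cyc (rotate k p) i = cyc p (i + k)"
  using assms by (simp add: cyc_def nth_rotate mod_simps add.commute)

lemma cyc_edges_rotate: "cyc_edges (rotate k p) = cyc_edges p"
proof -
  have sub: "cyc_edges (rotate l q) \<subseteq> cyc_edges q" for l and q :: "'a list"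
  proof
    fix e assume "e \<in> cyc_edges (rotate l q)"
    then obtain i where i: "i < length q" "e = cyc_edge (rotate l q) i"
      by (auto simp: cyc_edges_def)
    then have "q \<noteq> []" by auto
    then have "e = cyc_edge q (i + l)"
      by (simp add: i(2) cyc_edge_def cyc_rotate)
    then show "e \<in> cyc_edges q"
      using cyc_edge_in_cyc_edges \<open>q \<noteq> []\<close> by blast
  qed
  define l where "l = length p * k - k"
  have "k \<le> length p * k" if "p \<noteq> []"
    using that by (cases "length p") auto
  then have "rotate l (rotate k p) = p"
    by (cases "p = []") (simp_all add: rotate_rotate l_def rotate_id)
  then show ?thesis using sub [of k p] sub [of l "rotate k p"] by simp
qed

lemma belt_rotate: "belt G F (rotate k p) \<longleftrightarrow> belt G F p"
  by (simp add: belt_def is_cycle_def cyc_edges_rotate)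

lemma is_cycle_adjacent:
  assumes "is_cycle G p"
  shows "adjacent G (cyc p i) (cyc p (i + 1))"
proof -
  have "cyc_edge p i \<in> edges G"
    using assms cyc_edge_in_cyc_edges [of p i] unfolding is_cycle_def by fastforce
  then show ?thesis by (simp add: adjacent_def cyc_edge_def)
qed

lemma is_cycle_no_return:
  assumes "is_cycle G p"
  shows "cyc p i \<noteq> cyc p (i + 2)"
proof
  assume "cyc p i = cyc p (i + 2)"
  moreover have "distinct p" "p \<noteq> []" "3 \<le> length p"
    using assms by (auto simp: is_cycle_def)
  ultimately have "i mod length p = (i + 2) mod length p"
    using cyc_eq_iff by blast
  then have "length p dvd 2"
    using mod_eq_dvd_iff_nat [of i "i + 2" "length p"] by simp
  then have "length p \<le> 2" by (rule dvd_imp_le) simp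
  then show False using \<open>3 \<le> length p\<close> by simp
qed

context lattice_subgraph
begin

text \<open>The midpoint of an edge lies on no other edge.\<close>

lemma edge_midpoint_unique:
  assumes e: "{u, v} \<in> edges L" and e': "e' \<in> edges L"
    and m: "midpoint (embed u) (embed v) \<in> edge_segment e'"
  shows "e' = {u, v}"
  using e
proof (cases rule: edges_L_cases)
  case (horizontal x y)
  then have m': "(of_int x + 1/2, of_int y) \<in> edge_segment e'"
    using m by (auto simp: doubleton_eq_iff midpoint_def embed_def field_simps)
  from e' show ?thesis
  proof (cases rule: edges_L_cases)
    case h: (horizontal x' y')
    have "real_of_int x' \<le> of_int x + 1/2" "of_int x + 1/2 \<le> real_of_int x' + 1" "y' = y"
      using m' unfolding h(1) edge_segment_horizontal by auto
    then have "x' = x" by linarith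
    then show ?thesis using h(1) horizontal(1) \<open>y' = y\<close> by simp
  next
    case v: (vertical x' y')
    then show ?thesis
      using m' no_int_strictly_between [of x "of_int x + 1/2" x']
      unfolding v(1) edge_segment_vertical by auto
  qed
next
  case (vertical x y)
  then have m': "(of_int x, of_int y + 1/2) \<in> edge_segment e'"
    using m by (auto simp: doubleton_eq_iff midpoint_def embed_def field_simps)
  from e' show ?thesis
  proof (cases rule: edges_L_cases)
    case h: (horizontal x' y')
    then show ?thesis
      using m' no_int_strictly_between [of y "of_int y + 1/2" y']
      unfolding h(1) edge_segment_horizontal by auto
  next
    case v: (vertical x' y')
    have "real_of_int y' \<le> of_int y + 1/2" "of_int y + 1/2 \<le> real_of_int y' + 1" "x' = x"
      using m' unfolding v(1) edge_segment_vertical by auto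
    then have "y' = y" by linarith
    then show ?thesis using v(1) vertical(1) \<open>x' = x\<close> by simp
  qed
qed

lemma belt_cyc_edges:
  assumes "belt L F p"
  shows "cyc_edges p = {e \<in> edges L. edge_segment e \<subseteq> frontier F}"
proof (intro set_eqI iffI)
  fix e assume "e \<in> cyc_edges p"
  then show "e \<in> {e \<in> edges L. edge_segment e \<subseteq> frontier F}"
    using assms by (auto simp: belt_def is_cycle_def)
next
  fix e assume e: "e \<in> {e \<in> edges L. edge_segment e \<subseteq> frontier F}"
  then have "e \<in> edges L" by simp
  then obtain u v where uv: "e = {u, v}" by (rule edges_L_E)
  have "midpoint (embed u) (embed v) \<in> edge_segment e"
    by (simp add: uv edge_segment_def flip: segment_convex_hull)
  then have "midpoint (embed u) (embed v) \<in> (\<Union>e \<in> cyc_edges p. edge_segment e)"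
    using e assms by (auto simp: belt_def)
  then obtain e' where e': "e' \<in> cyc_edges p" "midpoint (embed u) (embed v) \<in> edge_segment e'"
    by blast
  moreover have "e' \<in> edges L"
    using e' assms by (auto simp: belt_def is_cycle_def)
  ultimately have "e' = e"
    using edge_midpoint_unique uv e by blast
  then show "e \<in> cyc_edges p" using e' by simp
qed

text \<open>The vertices of a belt depend only on the face, and not on the traversal.\<close>

lemma belt_set:
  assumes "belt L F p"
  shows "set p = \<Union> {e \<in> edges L. edge_segment e \<subseteq> frontier F}"
proof -
  have "p \<noteq> []" using assms by (auto simp: belt_def is_cycle_def)
  then have "set p = \<Union> (cyc_edges p)"
    using cyc_in_set [of p] by (auto simp: set_conv_cyc cyc_edges_def cyc_edge_def)
  then show ?thesis using belt_cyc_edges [OF assms] by simp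
qed

lemma belt_side:
  assumes "belt L F p"
  shows "F = face (left_cell (cyc p i) (cyc p (i + 1))) \<or>
    F = face (left_cell (cyc p (i + 1)) (cyc p i))"
proof -
  have cycle: "is_cycle L p" and F: "F \<in> faces L"
    using assms by (auto simp: belt_def)
  then have "p \<noteq> []" by (auto simp: is_cycle_def)
  then have "cyc_edge p i \<in> cyc_edges p" by (rule cyc_edge_in_cyc_edges)
  then have "edge_segment {cyc p i, cyc p (i + 1)} \<subseteq> frontier F"
    using belt_cyc_edges [OF assms] by (simp add: cyc_edge_def)
  moreover have "adjacent lattice_graph (cyc p i) (cyc p (i + 1))"
    using is_cycle_adjacent [OF cycle] by (simp add: adjacent_L)
  ultimately show ?thesis
    using F face_if_edge_subset_frontier by blast
qed

text \<open>A traversal is clockwise iff the square on the right of each of its edges lies in the face.\<close>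

lemma clockwise_belt_iff:
  "clockwise_belt L F p \<longleftrightarrow>
     belt L F p \<and> (\<forall>i. F = face (left_cell (cyc p (i + 1)) (cyc p i)))"
proof (cases "belt L F p")
  case True
  then have cycle: "is_cycle L p" and F: "F \<in> faces L"
    by (auto simp: belt_def)
  then have "length p > 0" by (auto simp: is_cycle_def)
  have adj: "adjacent lattice_graph (cyc p i) (cyc p (Suc i))" for i
    using is_cycle_adjacent [OF cycle, of i] by (simp add: adjacent_L)
  have "(\<forall>i<length p. on_right F (embed (cyc p i)) (embed (cyc p (Suc i)))) \<longleftrightarrow>
      (\<forall>i<length p. F = face (left_cell (cyc p (Suc i)) (cyc p i)))"
    using on_right_iff [OF adj F] by simp
  also have "\<dots> \<longleftrightarrow> (\<forall>i. F = face (left_cell (cyc p (Suc i)) (cyc p i)))"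
  proof (intro iffI allI impI)
    fix i
    assume "\<forall>i<length p. F = face (left_cell (cyc p (Suc i)) (cyc p i))"
    then have "F = face (left_cell (cyc p (Suc (i mod length p))) (cyc p (i mod length p)))"
      using mod_less_divisor [OF \<open>length p > 0\<close>] by blast
    then show "F = face (left_cell (cyc p (Suc i)) (cyc p i))"
      by (simp add: cyc_Suc_mod)
  qed auto
  finally show ?thesis
    using True by (simp add: clockwise_belt_def)
qed (simp add: clockwise_belt_def)

end

section \<open>Coloring the faces\<close>

text \<open>Here the deleted set is perfectly dominating.\<close>

locale perfect_domination = lattice_subgraph +
  assumes pds: "perfect_dominating_set lattice_graph S"
begin

text \<open>A point that is not deleted has exactly one deleted neighbor.\<close>

lemma dominator_cases:
  assumes "(x, y) \<notin> S"
  obtains (east) "(x + 1, y) \<in> S" "(x, y + 1) \<notin> S" "(x - 1, y) \<notin> S" "(x, y - 1) \<notin> S"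
  | (north) "(x + 1, y) \<notin> S" "(x, y + 1) \<in> S" "(x - 1, y) \<notin> S" "(x, y - 1) \<notin> S"
  | (west) "(x + 1, y) \<notin> S" "(x, y + 1) \<notin> S" "(x - 1, y) \<in> S" "(x, y - 1) \<notin> S"
  | (south) "(x + 1, y) \<notin> S" "(x, y + 1) \<notin> S" "(x - 1, y) \<notin> S" "(x, y - 1) \<in> S"
proof -
  have "(x, y) \<in> verts lattice_graph - S"
    using assms by (simp add: lattice_graph_def)
  then have "\<exists>!s. s \<in> S \<and> adjacent lattice_graph (x, y) s"
    using pds unfolding perfect_dominating_set_def by blast
  then obtain s where s: "s \<in> S" "adjacent lattice_graph (x, y) s"
    and uniq: "\<And>t. t \<in> S \<Longrightarrow> adjacent lattice_graph (x, y) t \<Longrightarrow> t = s"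
    by auto
  have u: "(x + 1, y) \<in> S \<Longrightarrow> s = (x + 1, y)" "(x, y + 1) \<in> S \<Longrightarrow> s = (x, y + 1)"
    "(x - 1, y) \<in> S \<Longrightarrow> s = (x - 1, y)" "(x, y - 1) \<in> S \<Longrightarrow> s = (x, y - 1)"
    using uniq by (force simp: adjacent_lattice_graph)+
  have "s \<in> {(x + 1, y), (x, y + 1), (x - 1, y), (x, y - 1)}"
    using s(2) by (cases s) (simp add: adjacent_lattice_graph)
  then show thesis
    using s(1) u that by (elim insertE emptyE) auto
qed

text \<open>
  The map is cubic and bipartite, so its faces can be colored with three colors such that the colors
  occur in counterclockwise cyclic order around each even vertex and in clockwise order around each
  odd one.
\<close>

lemma face_coloring_exists:
  obtains h where "\<And>K. h K \<noteq> (0 :: klein)"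
    "\<And>u v. adjacent L u v \<Longrightarrow> even (fst u + snd u) \<Longrightarrow>
      h (left_cell u v) = rot (h (left_cell v u))"
    "\<And>u v. adjacent lattice_graph u v \<Longrightarrow> \<not> adjacent L u v \<Longrightarrow>
      h (left_cell u v) = h (left_cell v u)"
proof -
  \<comment> \<open>The steps from the square \<open>(x, y)\<close> to the right and up cross the edges at \<open>(x + 1, y + 1)\<close>
    that lead down and left. The parity of this vertex is that of \<open>x + y\<close>.\<close>
  define A where "A x y = (if (x + 1, y) \<notin> S \<and> (x + 1, y + 1) \<notin> S
      then (if even (x + y) then rot else rot \<circ> rot) else id)" for x y
  define B where "B x y = (if (x, y + 1) \<notin> S \<and> (x + 1, y + 1) \<notin> S
      then (if even (x + y) then rot \<circ> rot else rot) else id)" for x y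
  have "bij (A x y)" "bij (B x y)" for x y
    unfolding A_def B_def by (auto intro: bij_rot bij_comp)
  moreover have "B (x + 1) y (A x y t) = A x (y + 1) (B x y t)" for x y t
  proof (cases "(x + 1, y + 1) \<in> S")
    case True
    then show ?thesis by (simp add: A_def B_def)
  next
    case False
    then show ?thesis
      by (cases rule: dominator_cases) (simp_all add: A_def B_def add_ac)
  qed
  ultimately obtain h where h: "h (0, 0) = K1" "\<And>x y. h (x + 1, y) = A x y (h (x, y))"
      "\<And>x y. h (x, y + 1) = B x y (h (x, y))"
    using integrate_plane [of A B K1] by metis
  show thesis
  proof
    have "A x y t \<noteq> 0 \<longleftrightarrow> t \<noteq> 0" "B x y t \<noteq> 0 \<longleftrightarrow> t \<noteq> 0" for x y t
      by (simp_all add: A_def B_def)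
    then have "h (x, y) \<noteq> 0" for x y
      by (induction rule: plane_induct) (simp_all add: h zero_klein_def)
    then show "h K \<noteq> 0" for K by (cases K) simp
  next
    fix u v assume uv: "adjacent L u v" and ev: "even (fst u + snd u)"
    then have "adjacent lattice_graph u v" "u \<notin> S" "v \<notin> S" by (simp_all add: adjacent_L)
    then show "h (left_cell u v) = rot (h (left_cell v u))"
    proof (cases rule: adjacent_lattice_cases)
      case (east x y)
      then show ?thesis using h(3) [of x "y - 1"] \<open>u \<notin> S\<close> \<open>v \<notin> S\<close> ev by (simp add: B_def)
    next
      case (north x y)
      then show ?thesis using h(2) [of "x - 1" y] \<open>u \<notin> S\<close> \<open>v \<notin> S\<close> ev by (simp add: A_def)
    next
      case (west x y)
      then show ?thesis
        using h(3) [of "x - 1" "y - 1"] \<open>u \<notin> S\<close> \<open>v \<notin> S\<close> ev by (simp add: B_def)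
    next
      case (south x y)
      then show ?thesis
        using h(2) [of "x - 1" "y - 1"] \<open>u \<notin> S\<close> \<open>v \<notin> S\<close> ev by (simp add: A_def)
    qed
  next
    fix u v assume uv: "adjacent lattice_graph u v" and non: "\<not> adjacent L u v"
    then have *: "\<not> (u \<notin> S \<and> v \<notin> S)" by (simp add: adjacent_L)
    from uv show "h (left_cell u v) = h (left_cell v u)"
    proof (cases rule: adjacent_lattice_cases)
      case (east x y)
      then show ?thesis using h(3) [of x "y - 1"] * by (auto simp: B_def)
    next
      case (north x y)
      then show ?thesis using h(2) [of "x - 1" y] * by (auto simp: A_def)
    next
      case (west x y)
      then show ?thesis using h(3) [of "x - 1" "y - 1"] * by (auto simp: B_def)
    next
      case (south x y)
      then show ?thesis using h(2) [of "x - 1" "y - 1"] * by (auto simp: A_def)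
    qed
  qed
qed

end

text \<open>
  A coloring \<open>h\<close> of the unit squares, hence of the faces, as provided by \<open>face_coloring_exists\<close>.
\<close>

locale face_colored = perfect_domination +
  fixes h :: "lattice_point \<Rightarrow> klein"
  assumes h_nonzero: "h K \<noteq> 0"
    and h_edge: "adjacent L u v \<Longrightarrow> even (fst u + snd u) \<Longrightarrow>
      h (left_cell u v) = rot (h (left_cell v u))"
    and h_nonedge: "adjacent lattice_graph u v \<Longrightarrow> \<not> adjacent L u v \<Longrightarrow>
      h (left_cell u v) = h (left_cell v u)"
begin

lemma h_cong: "face K = face K' \<Longrightarrow> h K = h K'"
  by (rule cell_function_constant_on_face) (rule h_nonedge)

lemma h_edge_odd:
  assumes "adjacent L u v" "odd (fst u + snd u)"
  shows "h (left_cell u v) = rot (rot (h (left_cell v u)))"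
proof -
  have "adjacent L v u" using assms(1) by (simp add: adjacent_sym)
  moreover have "adjacent lattice_graph u v" using assms(1) by (simp add: adjacent_L)
  then have "even (fst v + snd v)"
    using assms(2) by (cases rule: adjacent_lattice_cases) auto
  ultimately have "h (left_cell v u) = rot (h (left_cell u v))" by (rule h_edge)
  then show ?thesis by simp
qed

text \<open>The three squares on the left of the edges leaving a vertex lie in its three corners.\<close>

lemma corners_distinct_left:
  assumes v: "adjacent L w v" and v': "adjacent L w v'" and ne: "v \<noteq> v'"
  shows "h (left_cell w v) \<noteq> h (left_cell w v')"
proof -
  obtain x y where w: "w = (x, y)" by (cases w)
  define r where "r = (if even (x + y) then rot else rot \<circ> rot)"
  have wS: "(x, y) \<notin> S" using v by (simp add: adjacent_L w)
  have edge: "h (left_cell w u) = r (h (left_cell u w))" if "adjacent lattice_graph w u" "u \<notin> S" for u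
    using h_edge [of w u] h_edge_odd [of w u] that wS by (auto simp: r_def adjacent_L w)
  have nonedge: "h (left_cell w u) = h (left_cell u w)" if "adjacent lattice_graph w u" "u \<in> S" for u
    using h_nonedge [of w u] that by (simp add: adjacent_L)
  have E: "h (x, y) = (if (x + 1, y) \<in> S then h (x, y - 1) else r (h (x, y - 1)))"
    using edge [of "(x + 1, y)"] nonedge [of "(x + 1, y)"] by (simp add: w adjacent_lattice_graph)
  have N: "h (x - 1, y) = (if (x, y + 1) \<in> S then h (x, y) else r (h (x, y)))"
    using edge [of "(x, y + 1)"] nonedge [of "(x, y + 1)"] by (simp add: w adjacent_lattice_graph)
  have W: "h (x - 1, y - 1) = (if (x - 1, y) \<in> S then h (x - 1, y) else r (h (x - 1, y)))"
    using edge [of "(x - 1, y)"] nonedge [of "(x - 1, y)"] by (simp add: w adjacent_lattice_graph)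
  define b where "b = h (x, y - 1)"
  have r: "r b \<noteq> b" "r (r b) \<noteq> b" "r (r b) \<noteq> r b" "r (r (r b)) = b"
    using rot_neq [OF h_nonzero [of "(x, y - 1)"]] by (auto simp: r_def b_def)
  have vs: "v \<in> {(x + 1, y), (x, y + 1), (x - 1, y), (x, y - 1)} - S"
    "v' \<in> {(x + 1, y), (x, y + 1), (x - 1, y), (x, y - 1)} - S"
    using v v' by (cases v; cases v'; simp add: adjacent_L adjacent_lattice_graph w)+
  from wS show ?thesis
  proof (cases rule: dominator_cases)
    case east
    then have "h (x, y) = b" "h (x - 1, y) = r b" "h (x - 1, y - 1) = r (r b)"
      using E N W by (simp_all add: b_def)
    then show ?thesis using vs east ne r by (auto simp: w b_def [symmetric])
  next
    case north
    then have "h (x, y) = r b" "h (x - 1, y) = r b" "h (x - 1, y - 1) = r (r b)"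
      using E N W by (simp_all add: b_def)
    then show ?thesis using vs north ne r by (auto simp: w b_def [symmetric])
  next
    case west
    then have "h (x, y) = r b" "h (x - 1, y) = r (r b)" "h (x - 1, y - 1) = r (r b)"
      using E N W by (simp_all add: b_def)
    then show ?thesis using vs west ne r by (auto simp: w b_def [symmetric])
  next
    case south
    then have "h (x, y) = r b" "h (x - 1, y) = r (r b)" "h (x - 1, y - 1) = b"
      using E N W r by (simp_all add: b_def)
    then show ?thesis using vs south ne r by (auto simp: w b_def [symmetric])
  qed
qed

lemma corners_distinct_right:
  assumes v: "adjacent L w v" and v': "adjacent L w v'" and ne: "v \<noteq> v'"
  shows "h (left_cell v w) \<noteq> h (left_cell v' w)"
  using corners_distinct_left [OF assms] h_edge [OF v] h_edge [OF v'] h_edge_odd [OF v]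
    h_edge_odd [OF v'] by (cases "even (fst w + snd w)") auto

text \<open>The face color that does not occur next to the edge \<open>uv\<close>.\<close>

definition \<delta> :: "lattice_point \<Rightarrow> lattice_point \<Rightarrow> klein" where
  "\<delta> u v = h (left_cell u v) + h (left_cell v u)"

lemma \<delta>_commute: "\<delta> u v = \<delta> v u"
  by (simp add: \<delta>_def add.commute)

lemma h_sides_distinct:
  assumes "adjacent L u v"
  shows "h (left_cell u v) \<noteq> h (left_cell v u)"
  using h_edge [OF assms] h_edge_odd [OF assms] rot_neq [OF h_nonzero] by metis

lemma \<delta>_nonzero: "adjacent L u v \<Longrightarrow> \<delta> u v \<noteq> 0"
  using h_sides_distinct by (simp add: \<delta>_def)

lemma \<delta>_neq_sides:
  "\<delta> u v \<noteq> h (left_cell u v)" "\<delta> u v \<noteq> h (left_cell v u)"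
  using h_nonzero by (auto simp: \<delta>_def)

text \<open>At a vertex of given parity, the color of an edge is an injective function of the face on its
  right.\<close>

lemma \<delta>_right:
  assumes "adjacent L u v"
  shows "\<delta> u v =
    (if even (fst u + snd u) then rot (rot (h (left_cell v u))) else rot (h (left_cell v u)))"
  using h_edge [OF assms] h_edge_odd [OF assms] rot_add_self [of "h (left_cell v u)"]
    rot_add_self [of "rot (rot (h (left_cell v u)))"]
  by (auto simp: \<delta>_def add.commute)

lemma \<delta>_distinct:
  assumes "adjacent L w v" "adjacent L w v'" "v \<noteq> v'"
  shows "\<delta> w v \<noteq> \<delta> w v'"
  using corners_distinct_right [OF assms] \<delta>_right [OF assms(1)] \<delta>_right [OF assms(2)] by simp

text \<open>
  A face has only one corner at each vertex of its belt, because the three corners have different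
  colors. So a traversal that has the face on one side of an edge has it on the same side of the next.
\<close>

lemma belt_clockwise_or_rev:
  assumes belt: "belt L F p"
  shows "clockwise_belt L F p \<or> clockwise_belt L F (rev p)"
proof -
  have cycle: "is_cycle L p" using belt by (simp add: belt_def)
  then have "p \<noteq> []" by (auto simp: is_cycle_def)
  have adj: "adjacent L (cyc p i) (cyc p (i + 1))" for i
    using is_cycle_adjacent [OF cycle] .
  have adj2: "adjacent L (cyc p (i + 1)) (cyc p i)" "adjacent L (cyc p (i + 1)) (cyc p (i + 2))" for i
    using adj [of i] adj [of "i + 1"] by (simp_all add: adjacent_sym)
  have ne: "cyc p i \<noteq> cyc p (i + 2)" for i
    using is_cycle_no_return [OF cycle] .
  show ?thesis
  proof (cases "F = face (left_cell (cyc p 1) (cyc p 0))")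
    case True
    have "F = face (left_cell (cyc p (i + 1)) (cyc p i))" for i
    proof (induction i)
      case 0
      then show ?case using True by simp
    next
      case (Suc i)
      have "F \<noteq> face (left_cell (cyc p (i + 1)) (cyc p (i + 2)))"
        using Suc h_cong corners_distinct_left [OF adj2 ne] by metis
      then show ?case using belt_side [OF belt, of "i + 1"] by simp
    qed
    then show ?thesis using belt by (simp add: clockwise_belt_iff)
  next
    case False
    then have start: "F = face (left_cell (cyc p 0) (cyc p 1))"
      using belt_side [OF belt, of 0] by simp
    have left: "F = face (left_cell (cyc p i) (cyc p (i + 1)))" for i
    proof (induction i)
      case 0
      then show ?case using start by simp
    next
      case (Suc i)
      have "F \<noteq> face (left_cell (cyc p (i + 2)) (cyc p (i + 1)))"
        using Suc h_cong corners_distinct_right [OF adj2 ne] by metis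
      then show ?case using belt_side [OF belt, of "i + 1"] by simp
    qed
    have "F = face (left_cell (cyc (rev p) (i + 1)) (cyc (rev p) i))" for i
    proof -
      obtain j where "cyc (rev p) i = cyc p (j + 2)" "cyc (rev p) (i + 1) = cyc p (j + 1)"
        using \<open>p \<noteq> []\<close> by (rule cyc_rev_window)
      then show ?thesis using left [of "j + 1"] by simp
    qed
    then show ?thesis using belt by (simp add: clockwise_belt_iff belt_rev)
  qed
qed

text \<open>Along a belt, the two edge colors other than the color of the face alternate; any two consecutive
  edge colors therefore add up to the color of the face.\<close>

lemma belt_\<delta>:
  assumes belt: "belt L (face K) p"
  shows "\<delta> (cyc p i) (cyc p (i + 1)) + \<delta> (cyc p (i + 1)) (cyc p (i + 2)) = h K"
proof -
  have cycle: "is_cycle L p" using belt by (simp add: belt_def)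
  define d where "d i = \<delta> (cyc p i) (cyc p (i + 1))" for i
  have adj: "adjacent L (cyc p i) (cyc p (i + 1))" for i
    using is_cycle_adjacent [OF cycle] .
  have nz: "d i \<noteq> 0" for i
    unfolding d_def using \<delta>_nonzero adj by blast
  have neq: "d i \<noteq> d (i + 1)" for i
    using \<delta>_distinct [of "cyc p (i + 1)" "cyc p i" "cyc p (i + 2)"] adj [of i] adj [of "i + 1"]
      is_cycle_no_return [OF cycle] \<delta>_commute [of "cyc p i"]
    by (simp add: d_def adjacent_sym)
  have nh: "d i \<noteq> h K" for i
    using belt_side [OF belt, of i] h_cong \<delta>_neq_sides unfolding d_def by metis
  have "h K = d i + d (i + 1)"
    using klein_third [of "d i" "d (i + 1)" "h K"] nz neq nh h_nonzero by blast
  then show ?thesis by (simp add: d_def)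
qed

section \<open>Coloring the vertices\<close>

text \<open>The partial sums of \<open>\<delta>\<close> along a belt have period 4, so they close up if 4 divides its length.\<close>

lemma potential_on_face:
  assumes belt: "belt L F p" and len: "4 dvd length p"
  obtains g :: "lattice_point \<Rightarrow> klein"
  where "\<And>u v. adjacent L u v \<Longrightarrow> edge_segment {u, v} \<subseteq> frontier F \<Longrightarrow> g u + g v = \<delta> u v"
proof -
  have cycle: "is_cycle L p" and "F \<in> faces L" using belt by (auto simp: belt_def)
  have dist: "distinct p" using cycle by (simp add: is_cycle_def)
  obtain K where F: "F = face K"
    using \<open>F \<in> faces L\<close> by (rule faces_E)
  define d where "d i = \<delta> (cyc p i) (cyc p (i + 1))" for i
  define s where "s i = (\<Sum>j<i. d j)" for i
  have two: "s (Suc (Suc i)) = s i + h K" for i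
    using belt_\<delta> [of K p i] belt by (simp add: s_def d_def F add.assoc)
  have "s (i + 4) = s i" for i
    by (simp add: eval_nat_numeral two add.assoc)
  then have "s (4 * k) = s 0" for k
    by (induction k) (simp_all add: add.commute [of 4])
  then have s_len: "s (length p) = s 0" using len by auto
  \<comment> \<open>Off the belt the value is irrelevant.\<close>
  define g where "g v = s (THE i. i < length p \<and> p ! i = v)" for v
  have g: "g (cyc p i) = s i" if "i < length p" for i
    unfolding g_def using that dist
    by (intro arg_cong [where f = s] the_equality) (auto simp: cyc_nth nth_eq_iff_index_eq)
  have g_step: "g (cyc p i) + g (cyc p (i + 1)) = d i" if "i < length p" for i
  proof (cases "i + 1 < length p")
    case True
    then show ?thesis by (simp add: g s_def)
  next
    case False
    then have i: "length p = i + 1" using that by simp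
    then have "cyc p (i + 1) = cyc p 0"
      using cyc_add_length [of p 0] by simp
    moreover have "g (cyc p 0) = s (i + 1)"
      using g [of 0] s_len i by simp
    ultimately show ?thesis using that by (simp add: g s_def)
  qed
  show thesis
  proof
    fix u v assume "adjacent L u v" "edge_segment {u, v} \<subseteq> frontier F"
    then have "{u, v} \<in> cyc_edges p"
      using belt_cyc_edges [OF belt] by (simp add: adjacent_def)
    then obtain i where i: "i < length p" "{u, v} = {cyc p i, cyc p (i + 1)}"
      by (auto simp: cyc_edges_def cyc_edge_def)
    then show "g u + g v = \<delta> u v"
      using g_step [OF i(1)] \<delta>_commute [of u v] by (auto simp: doubleton_eq_iff d_def add.commute)
  qed
qed

text \<open>
  The potentials on the faces extend the edge coloring to the edges of the lattice that meet \<open>S\<close>, so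
  that the sum around every unit square is zero.
\<close>

lemma vertex_coloring_exists:
  assumes belts: "\<And>F. F \<in> faces L \<Longrightarrow> \<exists>p. belt L F p \<and> 4 dvd length p"
  obtains c :: "lattice_point \<Rightarrow> klein" where "\<And>u v. adjacent L u v \<Longrightarrow> c u + c v = \<delta> u v"
proof -
  have pot: "\<exists>g. \<forall>u v. adjacent L u v \<longrightarrow> edge_segment {u, v} \<subseteq> frontier F \<longrightarrow> g u + g v = \<delta> u v"
    if "F \<in> faces L" for F
    using belts [OF that] potential_on_face by metis
  then obtain G where G: "\<And>F u v. F \<in> faces L \<Longrightarrow> adjacent L u v \<Longrightarrow>
      edge_segment {u, v} \<subseteq> frontier F \<Longrightarrow> G F u + G F v = \<delta> u v"
    by metis
  \<comment> \<open>Off the edges of the subgraph, either side of the step gives the same face.\<close>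
  define \<omega> where "\<omega> u v = (if adjacent L u v then \<delta> u v
      else G (face (left_cell u v)) u + G (face (left_cell u v)) v)" for u v
  have \<omega>: "\<omega> u v = G (face K) u + G (face K) v"
    if "adjacent lattice_graph u v" "K = left_cell u v \<or> K = left_cell v u" for u v K
  proof (cases "adjacent L u v")
    case True
    then have "edge_segment {u, v} \<subseteq> frontier (face K)"
      using edge_segment_subset_frontier that(2) by blast
    then show ?thesis using True G [OF face_in_faces] by (simp add: \<omega>_def)
  next
    case False
    then have "face K = face (left_cell u v)"
      using face_eq_if_not_edge that by metis
    then show ?thesis using False by (simp add: \<omega>_def)
  qed
  define A where "A x y t = t + \<omega> (x, y) (x + 1, y)" for x y t
  define B where "B x y t = t + \<omega> (x, y) (x, y + 1)" for x y t
  have bij: "bij (\<lambda>t. t + a)" for a :: klein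
    by (rule involuntory_imp_bij) (simp add: add.assoc)
  have "bij (A x y)" "bij (B x y)" for x y
    unfolding A_def B_def by (rule bij)+
  moreover have "B (x + 1) y (A x y t) = A x (y + 1) (B x y t)" for x y t
  proof -
    have "\<omega> (x, y) (x + 1, y) = G (face (x, y)) (x, y) + G (face (x, y)) (x + 1, y)"
      "\<omega> (x + 1, y) (x + 1, y + 1) = G (face (x, y)) (x + 1, y) + G (face (x, y)) (x + 1, y + 1)"
      "\<omega> (x, y + 1) (x + 1, y + 1) = G (face (x, y)) (x, y + 1) + G (face (x, y)) (x + 1, y + 1)"
      "\<omega> (x, y) (x, y + 1) = G (face (x, y)) (x, y) + G (face (x, y)) (x, y + 1)"
      by (rule \<omega>; simp add: adjacent_lattice_graph)+
    then show ?thesis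
      by (simp add: A_def B_def add_ac)
  qed
  ultimately obtain c where c: "\<And>x y. c (x + 1, y) = A x y (c (x, y))"
      "\<And>x y. c (x, y + 1) = B x y (c (x, y))"
    using integrate_plane [of A B 0] by metis
  have \<omega>_commute: "\<omega> u v = \<omega> v u" if "adjacent lattice_graph u v" for u v
    using \<omega> [of u v "left_cell u v"] \<omega> [of v u "left_cell u v"] that
    by (simp add: adjacent_sym add.commute)
  have east: "c (x, y) + c (x + 1, y) = \<omega> (x, y) (x + 1, y)" for x y
    by (simp add: c A_def)
  have north: "c (x, y) + c (x, y + 1) = \<omega> (x, y) (x, y + 1)" for x y
    by (simp add: c B_def)
  have "c u + c v = \<delta> u v" if uv: "adjacent L u v" for u v
  proof -
    have adj: "adjacent lattice_graph u v" using uv by (simp add: adjacent_L)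
    then have "c u + c v = \<omega> u v"
    proof (cases rule: adjacent_lattice_cases)
      case (west x y)
      then show ?thesis
        using east [of "x - 1" y] \<omega>_commute [OF adj] by (simp add: add.commute)
    next
      case (south x y)
      then show ?thesis
        using north [of x "y - 1"] \<omega>_commute [OF adj] by (simp add: add.commute)
    qed (simp_all add: east north)
    then show ?thesis using uv by (simp add: \<omega>_def)
  qed
  then show thesis by (rule that)
qed

end

section \<open>The total colorings\<close>

lemma concat_map_periodic:
  fixes f :: "nat \<Rightarrow> 'a list"
  assumes "\<And>i. f (i + 4) = f i"
  shows "concat (map f [0..<4 * m]) = concat (replicate m (f 0 @ f 1 @ f 2 @ f 3))"
proof -
  have per: "f (4 * m + i) = f i" for m i
  proof (induction m)
    case (Suc m)
    have "f (4 * Suc m + i) = f ((4 * m + i) + 4)" by (simp add: add_ac)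
    then show ?case using Suc assms by simp
  qed simp
  show ?thesis
  proof (induction m)
    case (Suc m)
    have snoc: "replicate (Suc m) x = replicate m x @ [x]" for x :: "'a list"
      by (simp add: replicate_append_same)
    have "[0..<4 * Suc m] = [0..<4 * m] @ [4 * m..<4 * m + 4]"
      using upt_add_eq_append [of 0 "4 * m" 4] by (simp del: upt_Suc add: add.commute)
    also have "[4 * m..<4 * m + 4] = [4 * m, 4 * m + 1, 4 * m + 2, 4 * m + 3]"
      by (simp add: upt_conv_Cons del: upt_Suc)
    finally have "concat (map f [0..<4 * Suc m]) =
        concat (map f [0..<4 * m]) @ f 0 @ f 1 @ f 2 @ f 3"
      using per [of m 0] per [of m 1] per [of m 2] per [of m 3] by (simp del: upt_Suc)
    also have "\<dots> = concat (replicate (Suc m) (f 0 @ f 1 @ f 2 @ f 3))"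
      by (simp add: Suc snoc del: replicate.simps)
    finally show ?case .
  qed simp
qed

text \<open>
  A vertex coloring \<open>c\<close> whose differences are the edge colors \<open>\<delta>\<close>, for a map in which every face has a
  belt. The flag \<open>t\<close> selects the directed
  (true) or the reversed (false) total coloring.
\<close>

locale colored = face_colored +
  fixes c :: "lattice_point \<Rightarrow> klein" and t :: bool
  assumes c_edge: "adjacent L u v \<Longrightarrow> c u + c v = \<delta> u v"
    and belt_exists: "F \<in> faces L \<Longrightarrow> \<exists>p. belt L F p"
begin

text \<open>The final color of the edge \<open>uv\<close>: one of the two colors other than \<open>c u\<close> and \<open>c v\<close>.\<close>

definition \<kappa> :: "lattice_point \<Rightarrow> lattice_point \<Rightarrow> klein" where
  "\<kappa> u v = c u + h (if t then left_cell u v else left_cell v u)"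

text \<open>The total coloring. The value at an edge does not depend on the order of its ends, by
  \<open>\<kappa>_commute\<close>, so the description is unique.\<close>

definition \<mu> :: "lattice_point coloring" where
  "\<mu> x = code (case x of Inl v \<Rightarrow> c v
     | Inr e \<Rightarrow> (THE k. \<exists>u v. e = {u, v} \<and> adjacent L u v \<and> k = \<kappa> u v))"

lemma c_step: "adjacent L u v \<Longrightarrow> c v = c u + \<delta> u v"
  using c_edge [of u v] by (metis klein_add_self_left)

lemma \<kappa>_commute:
  assumes "adjacent L u v"
  shows "\<kappa> u v = \<kappa> v u"
  using c_step [OF assms] by (simp add: \<kappa>_def \<delta>_def add_ac)

lemma \<mu>_Inl [simp]: "\<mu> (Inl v) = code (c v)"
  by (simp add: \<mu>_def)

lemma \<mu>_Inr:
  assumes "adjacent L u v"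
  shows "\<mu> (Inr {u, v}) = code (\<kappa> u v)"
proof -
  have "(THE k. \<exists>u' v'. {u, v} = {u', v'} \<and> adjacent L u' v' \<and> k = \<kappa> u' v') = \<kappa> u v"
  proof (rule the_equality)
    show "\<exists>u' v'. {u, v} = {u', v'} \<and> adjacent L u' v' \<and> \<kappa> u v = \<kappa> u' v'"
      using assms by blast
  qed (use \<kappa>_commute in \<open>auto simp: doubleton_eq_iff\<close>)
  then show ?thesis by (simp add: \<mu>_def)
qed

lemma c_adjacent: "adjacent L u v \<Longrightarrow> c u \<noteq> c v"
  using c_edge \<delta>_nonzero by fastforce

lemma c_neighbours:
  assumes "adjacent L w v" "adjacent L w v'" "v \<noteq> v'"
  shows "c v \<noteq> c v'"
  using \<delta>_distinct [OF assms] c_edge [OF assms(1)] c_edge [OF assms(2)] by auto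

lemma \<kappa>_neq:
  assumes "adjacent L u v"
  shows "\<kappa> u v \<noteq> c u" "\<kappa> u v \<noteq> c v"
proof -
  have "\<kappa> u' v' \<noteq> c u'" for u' v'
    using h_nonzero by (simp add: \<kappa>_def)
  then show "\<kappa> u v \<noteq> c u" "\<kappa> u v \<noteq> c v"
    using \<kappa>_commute [OF assms] by metis+
qed

lemma \<kappa>_distinct:
  assumes "adjacent L w v" "adjacent L w v'" "v \<noteq> v'"
  shows "\<kappa> w v \<noteq> \<kappa> w v'"
  using corners_distinct_left [OF assms] corners_distinct_right [OF assms]
  by (simp add: \<kappa>_def)

lemma verts_nonempty: "verts L \<noteq> {}"
proof -
  obtain p where "belt L (face (0, 0)) p"
    using belt_exists face_in_faces by blast
  then have "set p \<subseteq> verts L" "p \<noteq> []"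
    by (auto simp: belt_def is_cycle_def)
  then show ?thesis by (cases p) auto
qed

lemma closed_nbhd_subset:
  assumes "w \<in> verts L"
  shows "closed_nbhd L w \<subseteq> verts L"
  using assms by (auto simp: closed_nbhd_def adjacent_L verts_L)

lemma closed_nbhd_bij:
  assumes "w \<in> verts L"
  shows "bij_betw (\<lambda>u. \<mu> (Inl u)) (closed_nbhd L w) {0..3}"
proof -
  obtain x y where w: "w = (x, y)" by (cases w)
  have wS: "(x, y) \<notin> S" using assms by (simp add: verts_L w)
  have nb: "closed_nbhd L w =
      insert w ({(x + 1, y), (x, y + 1), (x - 1, y), (x, y - 1)} - S)"
    using wS by (auto simp: closed_nbhd_def adjacent_L adjacent_lattice_graph w)
  have "inj_on c (closed_nbhd L w)"
  proof (rule inj_onI)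
    fix u v assume "u \<in> closed_nbhd L w" "v \<in> closed_nbhd L w" "c u = c v"
    then show "u = v"
      using c_adjacent [of w u] c_adjacent [of w v] c_neighbours [of w u v]
      by (auto simp: closed_nbhd_def)
  qed
  moreover from wS have "card (closed_nbhd L w) = 4"
    unfolding nb by (cases rule: dominator_cases) (simp_all add: w insert_Diff_if)
  ultimately show ?thesis
    using bij_betw_code by simp
qed

lemma edges_share_vertex:
  assumes "e \<in> edges L" "w \<in> e"
  obtains v where "e = {w, v}" "adjacent L w v"
proof -
  obtain u v where "e = {u, v}" "adjacent L u v"
    using assms(1) by (rule edges_L_E)
  then show thesis
    using assms(2) that [of u] that [of v] adjacent_sym [of L u v] by (auto simp: insert_commute)
qed

lemma total_coloring_\<mu>: "total_coloring L {0..3} \<mu>"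
  unfolding total_coloring_def
proof (intro conjI allI impI ballI)
  show "\<mu> ` (verts L <+> edges L) \<subseteq> {0..3}"
    unfolding \<mu>_def using code_in by (intro image_subsetI)
  show "\<mu> (Inl u) \<noteq> \<mu> (Inl v)" if "adjacent L u v" for u v
    using c_adjacent [OF that] by simp
  show "\<mu> (Inr e) \<noteq> \<mu> (Inr e')"
    if e: "e \<in> edges L" "e' \<in> edges L" and ne: "e \<noteq> e' \<and> e \<inter> e' \<noteq> {}" for e e'
  proof -
    obtain w where w: "w \<in> e" "w \<in> e'" using ne by blast
    obtain v where v: "e = {w, v}" "adjacent L w v" using e(1) w(1) by (rule edges_share_vertex)
    obtain v' where v': "e' = {w, v'}" "adjacent L w v'" using e(2) w(2) by (rule edges_share_vertex)
    have "v \<noteq> v'" using ne v v' by blast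
    then show ?thesis
      using \<kappa>_distinct [OF v(2) v'(2)] \<mu>_Inr v v' by simp
  qed
  show "\<mu> (Inl v) \<noteq> \<mu> (Inr e)" if e: "e \<in> edges L" "v \<in> e" for v e
  proof -
    obtain u where u: "e = {v, u}" "adjacent L v u" using e by (rule edges_share_vertex)
    then show ?thesis using \<kappa>_neq(1) [OF u(2)] \<mu>_Inr by simp
  qed
qed

lemma efficient_class:
  assumes "k \<in> {0..3}" "w \<in> verts L"
  shows "\<exists>u. closed_nbhd L w \<inter> vertex_class L \<mu> k = {u}"
proof -
  have bij: "bij_betw (\<lambda>u. \<mu> (Inl u)) (closed_nbhd L w) {0..3}"
    using assms(2) by (rule closed_nbhd_bij)
  have "k \<in> (\<lambda>u. \<mu> (Inl u)) ` closed_nbhd L w"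
    using bij_betw_imp_surj_on [OF bij] assms(1) by simp
  then obtain u where u: "u \<in> closed_nbhd L w" "\<mu> (Inl u) = k"
    by blast
  have "closed_nbhd L w \<inter> vertex_class L \<mu> k = {v \<in> closed_nbhd L w. \<mu> (Inl v) = k}"
    using closed_nbhd_subset [OF assms(2)] by (auto simp: vertex_class_def)
  also have "\<dots> = {u}"
    using u bij by (auto simp: bij_betw_def inj_on_def)
  finally show ?thesis by blast
qed

lemma ETC_\<mu>: "ETC L \<mu>"
  unfolding ETC_def
proof (intro conjI ballI)
  show "partition_on (verts L) (vertex_class L \<mu> ` {0..3})"
  proof (rule partition_onI)
    have "\<mu> (Inl v) \<in> {0..3}" for v using code_in by simp
    then show "\<Union> (vertex_class L \<mu> ` {0..3}) = verts L"
      by (fastforce simp: vertex_class_def)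
    show "disjnt C D" if "C \<in> vertex_class L \<mu> ` {0..3}" "D \<in> vertex_class L \<mu> ` {0..3}" "C \<noteq> D"
      for C D
      using that by (auto simp: vertex_class_def disjnt_def)
    obtain w where "w \<in> verts L" using verts_nonempty by blast
    then show "{} \<notin> vertex_class L \<mu> ` {0..3}"
      using efficient_class by fastforce
  qed
  show "efficient_dominating_set L (vertex_class L \<mu> k)" if "k \<in> {0..3}" for k
    unfolding efficient_dominating_set_def
  proof (intro conjI ballI)
    show "vertex_class L \<mu> k \<subseteq> verts L" by (auto simp: vertex_class_def)
    show "card (closed_nbhd L v \<inter> vertex_class L \<mu> k) = 1" if "v \<in> verts L" for v
      using efficient_class [OF \<open>k \<in> {0..3}\<close> that] by auto
  qed
qed (use total_coloring_\<mu> closed_nbhd_bij in auto)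

text \<open>
  On any 4-cycle, adjacent vertices as well as opposite ones, which have a common neighbor, get
  distinct colors. The color of an edge is then that of one of the two vertices opposite to it, so
  opposite edges have distinct colors, too.
\<close>

lemma ETGC_\<mu>: "ETGC L \<mu>"
  unfolding ETGC_def
proof (intro conjI allI impI)
  show "ETC L \<mu>" by (rule ETC_\<mu>)
  fix p assume p: "is_cycle L p \<and> length p = 4"
  then have cycle: "is_cycle L p" and len: "length p = 4" and dist: "distinct p"
    by (auto simp: is_cycle_def)
  have adj: "adjacent L (cyc p i) (cyc p (i + 1))" for i
    using is_cycle_adjacent [OF cycle] .
  have four: "cyc p 4 = cyc p 0"
    using cyc_add_length [of p 0] len by simp
  have adj': "adjacent L (cyc p 0) (cyc p 1)" "adjacent L (cyc p 1) (cyc p 2)"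
    "adjacent L (cyc p 2) (cyc p 3)" "adjacent L (cyc p 3) (cyc p 0)"
    using adj [of 0] adj [of 1] adj [of 2] adj [of 3] four by (simp_all add: eval_nat_numeral)
  have set: "set p = {cyc p 0, cyc p 1, cyc p 2, cyc p 3}"
    using len by (auto simp: set_conv_cyc eval_nat_numeral less_Suc_eq)
  have edges: "cyc_edges p = {{cyc p 0, cyc p 1}, {cyc p 1, cyc p 2}, {cyc p 2, cyc p 3},
      {cyc p 3, cyc p 0}}"
    using len four
    by (auto simp: cyc_edges_def cyc_edge_def eval_nat_numeral lessThan_Suc)
  have ne: "cyc p 0 \<noteq> cyc p 2" "cyc p 1 \<noteq> cyc p 3"
    using is_cycle_no_return [OF cycle, of 0] is_cycle_no_return [OF cycle, of 1]
    by (simp_all add: eval_nat_numeral)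
  have dc: "distinct [c (cyc p 0), c (cyc p 1), c (cyc p 2), c (cyc p 3)]"
    using c_adjacent adj' c_neighbours [of "cyc p 1" "cyc p 0" "cyc p 2"]
      c_neighbours [of "cyc p 2" "cyc p 1" "cyc p 3"] ne
    by (auto simp: adjacent_sym)
  then have "inj_on c (set p)"
    unfolding set by (auto simp: inj_on_def)
  moreover have "card (set p) = 4" using dist len distinct_card by metis
  ultimately show "bij_betw (\<lambda>v. \<mu> (Inl v)) (set p) {0..3}"
    using bij_betw_code by simp
  define k0 k1 k2 k3 where k: "k0 = \<kappa> (cyc p 0) (cyc p 1)" "k1 = \<kappa> (cyc p 1) (cyc p 2)"
    "k2 = \<kappa> (cyc p 2) (cyc p 3)" "k3 = \<kappa> (cyc p 3) (cyc p 0)"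
  have "k0 \<noteq> k1" "k1 \<noteq> k2" "k2 \<noteq> k3" "k3 \<noteq> k0"
    unfolding k
    using \<kappa>_distinct [of "cyc p 1" "cyc p 0" "cyc p 2"] \<kappa>_distinct [of "cyc p 2" "cyc p 1" "cyc p 3"]
      \<kappa>_distinct [of "cyc p 3" "cyc p 2" "cyc p 0"] \<kappa>_distinct [of "cyc p 0" "cyc p 3" "cyc p 1"]
      adj' ne \<kappa>_commute [OF adj'(1)] \<kappa>_commute [OF adj'(2)] \<kappa>_commute [OF adj'(3)]
      \<kappa>_commute [OF adj'(4)]
    by (auto simp: adjacent_sym)
  moreover have "k0 \<in> {c (cyc p 2), c (cyc p 3)}" "k1 \<in> {c (cyc p 3), c (cyc p 0)}"
    "k2 \<in> {c (cyc p 0), c (cyc p 1)}" "k3 \<in> {c (cyc p 1), c (cyc p 2)}"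
    unfolding k
    using four_kleins [OF dc] \<kappa>_neq [OF adj'(1)] \<kappa>_neq [OF adj'(2)] \<kappa>_neq [OF adj'(3)]
      \<kappa>_neq [OF adj'(4)] by blast+
  ultimately have "distinct [k0, k1, k2, k3]"
    using dc by auto
  then have "{k0, k1, k2, k3} = UNIV" by (rule four_kleins)
  then have "code ` {k0, k1, k2, k3} = {0..3}" using range_code by simp
  moreover have "(\<lambda>e. \<mu> (Inr e)) ` cyc_edges p = code ` {k0, k1, k2, k3}"
    unfolding edges k by (simp only: image_insert image_empty adj' [THEN \<mu>_Inr])
  ultimately have im: "(\<lambda>e. \<mu> (Inr e)) ` cyc_edges p = {0..3}" by simp
  have fin: "finite (cyc_edges p)" by (simp add: cyc_edges_def)
  have "card (cyc_edges p) \<le> 4"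
    unfolding cyc_edges_def using card_image_le [of "{..<length p}" "cyc_edge p"] len by simp
  moreover have "4 \<le> card (cyc_edges p)"
    using card_image_le [OF fin, of "\<lambda>e. \<mu> (Inr e)"] im by simp
  ultimately have "card ((\<lambda>e. \<mu> (Inr e)) ` cyc_edges p) = card (cyc_edges p)"
    using im by simp
  then show "bij_betw (\<lambda>e. \<mu> (Inr e)) (cyc_edges p) {0..3}"
    unfolding bij_betw_def using im eq_card_imp_inj_on [OF fin] by blast
qed

section \<open>The color pattern along a belt\<close>

lemma belt_c_add_2:
  assumes "belt L (face K) p"
  shows "c (cyc p (i + 2)) = c (cyc p i) + h K"
proof -
  have cycle: "is_cycle L p" using assms by (simp add: belt_def)
  show ?thesis
    using c_step [OF is_cycle_adjacent [OF cycle, of i]]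
      c_step [OF is_cycle_adjacent [OF cycle, of "i + 1"]] belt_\<delta> [OF assms, of i]
    by (simp add: add.assoc)
qed

lemma belt_c_add_4:
  assumes "belt L F p"
  shows "c (cyc p (i + 4)) = c (cyc p i)"
proof -
  obtain K where "F = face K"
    using assms faces_E unfolding belt_def by metis
  then show ?thesis
    using belt_c_add_2 [of K p i] belt_c_add_2 [of K p "i + 2"] assms
    by (simp add: add.assoc eval_nat_numeral)
qed

lemma belt_c_distinct:
  assumes "belt L F p"
  shows "distinct [c (cyc p i), c (cyc p (i + 1)), c (cyc p (i + 2)), c (cyc p (i + 3))]"
proof -
  have cycle: "is_cycle L p" using assms by (simp add: belt_def)
  obtain K where K: "F = face K"
    using assms faces_E unfolding belt_def by metis
  have adj: "adjacent L (cyc p j) (cyc p (j + 1))" for j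
    using is_cycle_adjacent [OF cycle] .
  have near: "c (cyc p j) \<noteq> c (cyc p (j + 1))" "c (cyc p j) \<noteq> c (cyc p (j + 2))" for j
    using c_adjacent [OF adj] belt_c_add_2 [of K p j] assms K h_nonzero [of K] by auto
  have "c (cyc p (i + 3)) \<noteq> c (cyc p i)"
    using c_adjacent [OF adj [of "i + 3"]] belt_c_add_4 [OF assms, of i]
    by (simp add: eval_nat_numeral)
  then show ?thesis
    using near [of i] near [of "i + 1"] near(1) [of "i + 2"]
    by (simp add: eval_nat_numeral)
qed

lemma belt_c_distinct_start:
  assumes "belt L F p"
  shows "distinct [c (cyc p 0), c (cyc p 1), c (cyc p 2), c (cyc p 3)]"
  using belt_c_distinct [OF assms, of 0] by (simp only: add_0)

lemma belt_c_add_mult_4: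
  assumes "belt L F p"
  shows "c (cyc p (i + 4 * m)) = c (cyc p i)"
proof (induction m)
  case (Suc m)
  have "c (cyc p (i + 4 * Suc m)) = c (cyc p ((i + 4 * m) + 4))" by (simp add: add_ac)
  then show ?case using Suc belt_c_add_4 [OF assms] by simp
qed simp

lemma belt_c_eq_start:
  assumes "belt L F p" "c (cyc p i) = c (cyc p 0)"
  shows "4 dvd i"
proof -
  have "c (cyc p (i mod 4)) = c (cyc p 0)"
    using assms(2) belt_c_add_mult_4 [OF assms(1), of "i mod 4" "i div 4"] by simp
  moreover have "i mod 4 \<in> {0, 1, 2, 3}" by auto
  ultimately have "i mod 4 = 0"
    using belt_c_distinct_start [OF assms(1)] by auto
  then show ?thesis by (simp add: dvd_eq_mod_eq_0)
qed

lemma belt_length: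
  assumes "belt L F p"
  shows "4 dvd length p"
  using belt_c_eq_start [OF assms, of "length p"] cyc_add_length [of p 0] by simp

text \<open>
  Traversed clockwise or counterclockwise, depending on the coloring, every edge of a belt has the
  color of the vertex one step before it.
\<close>

lemma clockwise_edge_colors:
  assumes "clockwise_belt L F p"
  obtains q where "q = (if t then p else rev p)" "belt L F q"
    "\<And>i. \<kappa> (cyc q (i + 1)) (cyc q (i + 2)) = c (cyc q i)"
proof
  define q where "q = (if t then p else rev p)"
  have belt: "belt L F p" and right: "\<And>i. F = face (left_cell (cyc p (i + 1)) (cyc p i))"
    using assms by (auto simp: clockwise_belt_iff)
  have cycle: "is_cycle L p" using belt by (simp add: belt_def)
  then have "p \<noteq> []" by (auto simp: is_cycle_def)
  have adj: "adjacent L (cyc p i) (cyc p (i + 1))" for i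
    using is_cycle_adjacent [OF cycle] .
  obtain K where K: "F = face K"
    using belt faces_E unfolding belt_def by metis
  have hK: "h (left_cell (cyc p (i + 1)) (cyc p i)) = h K" for i
    using right [of i] K h_cong by metis
  have d: "\<delta> (cyc p i) (cyc p (i + 1)) + \<delta> (cyc p (i + 1)) (cyc p (i + 2)) = h K" for i
    using belt_\<delta> belt K by blast
  show "q = (if t then p else rev p)" by (fact q_def)
  show "belt L F q" using belt by (simp add: q_def belt_rev)
  fix i
  show "\<kappa> (cyc q (i + 1)) (cyc q (i + 2)) = c (cyc q i)"
  proof (cases t)
    case True
    have "\<delta> (cyc p (i + 1)) (cyc p (i + 2)) = h (left_cell (cyc p (i + 1)) (cyc p (i + 2))) + h K"
      using hK [of "i + 1"] by (simp add: \<delta>_def)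
    then have "\<delta> (cyc p i) (cyc p (i + 1)) = h (left_cell (cyc p (i + 1)) (cyc p (i + 2)))"
      using d [of i] by (metis add.commute add.left_commute klein_add_self_left)
    then have "c (cyc p (i + 1)) = c (cyc p i) + h (left_cell (cyc p (i + 1)) (cyc p (i + 2)))"
      using c_step [OF adj] by simp
    then show ?thesis unfolding \<kappa>_def q_def using True by (simp add: add.assoc)
  next
    case False
    obtain j where j: "cyc (rev p) i = cyc p (j + 2)" "cyc (rev p) (i + 1) = cyc p (j + 1)"
        "cyc (rev p) (i + 2) = cyc p j"
      using \<open>p \<noteq> []\<close> by (rule cyc_rev_window)
    have "\<kappa> (cyc p (j + 1)) (cyc p j) = \<kappa> (cyc p j) (cyc p (j + 1))"
      using \<kappa>_commute adj by metis
    also have "\<dots> = c (cyc p j) + h K"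
      unfolding \<kappa>_def using False hK [of j] by simp
    also have "\<dots> = c (cyc p (j + 2))"
      using belt_c_add_2 [of K p j] belt K by simp
    finally show ?thesis unfolding q_def using False j by simp
  qed
qed

lemma directed_along_clockwise:
  assumes "clockwise_belt L F p"
  shows "directed_along \<mu> (if t then p else rev p)"
proof -
  obtain q where q: "q = (if t then p else rev p)" "belt L F q"
    and col: "\<And>i. \<kappa> (cyc q (i + 1)) (cyc q (i + 2)) = c (cyc q i)"
    using clockwise_edge_colors [OF assms] by blast
  have cycle: "is_cycle L q" using q(2) by (simp add: belt_def)
  then have pos: "length q > 0" by (auto simp: is_cycle_def)
  have "directed_along \<mu> q"
    unfolding directed_along_def
  proof (intro ballI impI)
    fix e assume "e \<in> cyc_edges q" and zero: "\<mu> (Inr e) = 0"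
    then obtain i where e: "e = cyc_edge q i" by (auto simp: cyc_edges_def)
    \<comment> \<open>The position before \<open>i\<close>; the length is added because \<open>i\<close> may be 0.\<close>
    define j where "j = i + length q - 1"
    have "e = cyc_edge q (j + 1)"
      using pos by (simp add: e j_def cyc_edge_def flip: add_Suc)
    moreover have "adjacent L (cyc q (j + 1)) (cyc q (j + 2))"
      using is_cycle_adjacent [OF cycle, of "j + 1"] by simp
    ultimately have "\<mu> (Inr e) = code (c (cyc q j))"
      using \<mu>_Inr col [of j] by (simp add: cyc_edge_def)
    then have "\<mu> (Inl (cyc q (j mod length q))) = 0"
      using zero by simp
    moreover have "e = cyc_edge q (j mod length q + 1)"
      using \<open>e = cyc_edge q (j + 1)\<close> cyc_Suc_mod [of q j] cyc_Suc_mod [of q "Suc j"]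
      by (metis Suc_eq_plus1 cyc_edge_mod mod_Suc_eq)
    ultimately show "\<exists>j<length q. \<mu> (Inl (cyc q j)) = 0 \<and> e = cyc_edge q (j + 1)"
      using pos by (intro exI [of _ "j mod length q"]) simp
  qed
  then show ?thesis using q(1) by simp
qed

text \<open>With \<open>a\<close>, \<open>c\<close>, \<open>d\<close>, \<open>b\<close> as the colors of the first four vertices, in this order.\<close>

lemma color_sequence_clockwise:
  assumes "clockwise_belt L F p"
  shows "\<exists>a b c d m. {a, b, c, d} = {0..3} \<and>
    color_sequence \<mu> (if t then p else rev p) = concat (replicate m [a, b, c, a, d, c, b, d])"
proof -
  obtain q where q: "q = (if t then p else rev p)" "belt L F q"
    and col: "\<And>i. \<kappa> (cyc q (i + 1)) (cyc q (i + 2)) = c (cyc q i)"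
    using clockwise_edge_colors [OF assms] by blast
  have cycle: "is_cycle L q" using q(2) by (simp add: belt_def)
  then have pos: "length q > 0" by (auto simp: is_cycle_def)
  obtain m where m: "length q = 4 * m"
    using belt_length [OF q(2)] by blast
  define x where "x i = c (cyc q i)" for i
  have x4: "x (i + 4) = x i" for i
    unfolding x_def by (rule belt_c_add_4 [OF q(2)])
  have edge: "\<mu> (Inr (cyc_edge q i)) = code (x (i + 3))" for i
  proof -
    have adj: "adjacent L (cyc q i) (cyc q (i + 1))"
      using is_cycle_adjacent [OF cycle] .
    have "\<kappa> (cyc q i) (cyc q (i + 1)) = x (i + length q - 1)"
      using col [of "i + length q - 1"] pos by (simp add: x_def flip: add_Suc)
    also have "i + length q - 1 = (i + 3) + 4 * (m - 1)"
      using m pos by (cases m) auto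
    also have "x ((i + 3) + 4 * (m - 1)) = x (i + 3)"
      unfolding x_def by (rule belt_c_add_mult_4 [OF q(2)])
    finally show ?thesis using \<mu>_Inr [OF adj] by (simp add: cyc_edge_def)
  qed
  define f where "f i = [code (x i), code (x (i + 3))]" for i
  have "color_sequence \<mu> q = concat (map f [0..<4 * m])"
    unfolding color_sequence_def m f_def by (simp add: edge x_def)
  also have "\<dots> = concat (replicate m (f 0 @ f 1 @ f 2 @ f 3))"
  proof (rule concat_map_periodic)
    show "f (i + 4) = f i" for i
      using x4 [of i] x4 [of "i + 3"] by (simp add: f_def add_ac)
  qed
  also have "f 0 @ f 1 @ f 2 @ f 3 = [code (x 0), code (x 3), code (x 1), code (x 0),
      code (x 2), code (x 1), code (x 3), code (x 2)]"
    using x4 [of 0] x4 [of 1] x4 [of 2] by (simp add: f_def eval_nat_numeral)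
  finally have seq: "color_sequence \<mu> q = concat (replicate m [code (x 0), code (x 3), code (x 1),
      code (x 0), code (x 2), code (x 1), code (x 3), code (x 2)])" .
  have "{x 0, x 1, x 2, x 3} = UNIV"
    unfolding x_def using belt_c_distinct_start [OF q(2)] by (rule four_kleins)
  then have "code ` {x 0, x 1, x 2, x 3} = {0..3}" using range_code by simp
  then have "{code (x 0), code (x 3), code (x 1), code (x 2)} = {0..3}" by auto
  then show ?thesis using seq q(1) by blast
qed

lemma periodic_\<mu>: "periodic L \<mu>"
  unfolding periodic_def
proof (intro allI impI)
  fix F p assume "belt L F p"
  then obtain p' where "clockwise_belt L F p'" "p' \<in> {p, rev p}"
    using belt_clockwise_or_rev by blast
  moreover define q where "q = (if t then p' else rev p')"
  ultimately have q: "q \<in> {p, rev p}" "\<exists>a b c d m. {a, b, c, d} = {0..3} \<and>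
    color_sequence \<mu> q = concat (replicate m [a, b, c, a, d, c, b, d])"
    using color_sequence_clockwise by auto
  then show "\<exists>q\<in>{p, rev p}. \<exists>k a b c d m. {a, b, c, d} = {0..3} \<and>
      color_sequence \<mu> (rotate k q) = concat (replicate m [a, b, c, a, d, c, b, d])"
    using rotate0 [THEN fun_cong, of q] by (metis id_apply)
qed

section \<open>The corresponding coloring of the faces by permutations\<close>

lemma clockwise_start:
  assumes "clockwise_belt L (face K) p" "c (cyc p 0) = 0"
  shows "c (cyc p 1) = \<delta> (cyc p 0) (cyc p 1)" "c (cyc p 2) = h K"
    "c (cyc p 3) = h K + \<delta> (cyc p 0) (cyc p 1)"
proof -
  have belt: "belt L (face K) p" using assms by (simp add: clockwise_belt_iff)
  then have cycle: "is_cycle L p" by (simp add: belt_def)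
  show "c (cyc p 1) = \<delta> (cyc p 0) (cyc p 1)"
    using c_step [OF is_cycle_adjacent [OF cycle, of 0]] assms(2) by simp
  then show "c (cyc p 2) = h K" "c (cyc p 3) = h K + \<delta> (cyc p 0) (cyc p 1)"
    using belt_c_add_2 [OF belt, of 0] belt_c_add_2 [OF belt, of 1] assms(2)
    by (simp_all add: eval_nat_numeral add.commute)
qed

lemma clockwise_start_exists:
  assumes "F \<in> faces L"
  shows "\<exists>p. clockwise_belt L F p \<and> c (cyc p 0) = 0"
proof -
  obtain p where p: "clockwise_belt L F p"
    using belt_exists [OF assms] belt_clockwise_or_rev by blast
  then have belt: "belt L F p" by (simp add: clockwise_belt_iff)
  then have "p \<noteq> []" by (auto simp: belt_def is_cycle_def)
  have "0 \<in> {c (cyc p 0), c (cyc p 1), c (cyc p 2), c (cyc p 3)}"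
    using four_kleins [OF belt_c_distinct_start [OF belt]] by blast
  then obtain k where "c (cyc p k) = 0" by auto
  then have "clockwise_belt L F (rotate k p) \<and> c (cyc (rotate k p) 0) = 0"
    using p \<open>p \<noteq> []\<close> by (simp add: clockwise_belt_iff belt_rotate cyc_rotate)
  then show ?thesis by blast
qed

lemma parity_along_cycle:
  assumes "is_cycle L p" "even i"
  shows "even (fst (cyc p i) + snd (cyc p i)) \<longleftrightarrow> even (fst (cyc p 0) + snd (cyc p 0))"
proof -
  have flip: "even (fst v + snd v) \<longleftrightarrow> odd (fst u + snd u)" if "adjacent L u v" for u v
  proof -
    have "adjacent lattice_graph u v" using that by (simp add: adjacent_L)
    then show ?thesis by (cases rule: adjacent_lattice_cases) auto
  qed
  obtain j where "i = 2 * j" using assms(2) by blast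
  moreover have "even (fst (cyc p (2 * j)) + snd (cyc p (2 * j))) \<longleftrightarrow>
      even (fst (cyc p 0) + snd (cyc p 0))"
  proof (induction j)
    case (Suc j)
    then show ?case
      using flip [OF is_cycle_adjacent [OF assms(1), of "2 * j"]]
        flip [OF is_cycle_adjacent [OF assms(1), of "2 * j + 1"]] by simp
  qed simp
  ultimately show ?thesis by simp
qed

text \<open>
  The color after a vertex of color 0 is determined by the face and the parity of that vertex, and
  vertices of the same color on a belt have the same parity.
\<close>

lemma clockwise_start_unique:
  assumes p: "clockwise_belt L (face K) p" "c (cyc p 0) = 0"
    and p': "clockwise_belt L (face K) p'" "c (cyc p' 0) = 0"
  shows "\<delta> (cyc p 0) (cyc p 1) = \<delta> (cyc p' 0) (cyc p' 1)"
proof -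
  have belt: "belt L (face K) p" "belt L (face K) p'"
    using p p' by (simp_all add: clockwise_belt_iff)
  then have cycle: "is_cycle L p" "is_cycle L p'" by (simp_all add: belt_def)
  have "cyc p' 0 \<in> set p'"
    using cycle(2) by (intro cyc_in_set) (auto simp: is_cycle_def)
  then have "cyc p' 0 \<in> set p"
    using belt_set [OF belt(1)] belt_set [OF belt(2)] by simp
  then obtain j where j: "cyc p' 0 = cyc p j" by (auto simp: set_conv_cyc)
  then have "4 dvd j"
    using belt_c_eq_start [OF belt(1), of j] p(2) p'(2) by simp
  then have "even j" by (metis dvd_trans even_numeral)
  have par: "even (fst (cyc p' 0) + snd (cyc p' 0)) \<longleftrightarrow> even (fst (cyc p 0) + snd (cyc p 0))"
    using parity_along_cycle [OF cycle(1) \<open>even j\<close>] unfolding j .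
  have "h (left_cell (cyc q 1) (cyc q 0)) = h K" if "clockwise_belt L (face K) q" for q
    using that h_cong unfolding clockwise_belt_iff by (metis add_0)
  then show ?thesis
    using \<delta>_right [OF is_cycle_adjacent [OF cycle(1), of 0]]
      \<delta>_right [OF is_cycle_adjacent [OF cycle(2), of 0]] par p(1) p'(1) by simp
qed

lemma corresponding_PFC_exists: "\<exists>\<phi>. corresponding_PFC L \<mu> \<phi>"
proof -
  define P where "P F = (SOME p. clockwise_belt L F p \<and> c (cyc p 0) = 0)" for F
  have P: "clockwise_belt L F (P F)" "c (cyc (P F) 0) = 0" if "F \<in> faces L" for F
    using someI_ex [OF clockwise_start_exists [OF that]] by (simp_all add: P_def)
  define \<phi> where "\<phi> F = [\<mu> (Inl (cyc (P F) 1)), \<mu> (Inl (cyc (P F) 2)), \<mu> (Inl (cyc (P F) 3))]" for F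
  have \<phi>_face: "\<phi> (face K) = [code (\<delta> (cyc (P (face K)) 0) (cyc (P (face K)) 1)), code (h K),
      code (h K + \<delta> (cyc (P (face K)) 0) (cyc (P (face K)) 1))]" for K
    using clockwise_start [OF P [OF face_in_faces]] by (simp add: \<phi>_def)
  have perm: "\<phi> F \<in> permutations_of_set {1, 2, 3}" if F: "F \<in> faces L" for F
  proof -
    define y where "y i = c (cyc (P F) i)" for i
    have "distinct [y 0, y 1, y 2, y 3]" "y 0 = 0"
      using belt_c_distinct_start [of F "P F"] P [OF F] by (simp_all add: y_def clockwise_belt_iff)
    then have "set [code (y 1), code (y 2), code (y 3)] = {1, 2, 3}"
        "distinct [code (y 1), code (y 2), code (y 3)]"
      by (cases "y 1"; cases "y 2"; cases "y 3"; auto simp: zero_klein_def)+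
    then show ?thesis
      unfolding \<phi>_def by (intro permutations_of_setI) (simp_all add: y_def)
  qed
  have unique: "\<phi> F = [\<mu> (Inl (cyc p 1)), \<mu> (Inl (cyc p 2)), \<mu> (Inl (cyc p 3))]"
    if F: "F \<in> faces L" and p: "clockwise_belt L F p" "c (cyc p 0) = 0" for F p
  proof -
    obtain K where K: "F = face K" using F by (rule faces_E)
    have "clockwise_belt L (face K) p" using p(1) K by simp
    then show ?thesis
      using clockwise_start [of K p] clockwise_start_unique [of K p "P (face K)"] p(2)
        P [OF face_in_faces] \<phi>_face [of K] K by simp
  qed
  have proper: "\<phi> F \<noteq> \<phi> F'" if adj: "adjacent_faces L F F'" for F F'
  proof -
    obtain e where e: "e \<in> edges L" "edge_segment e \<subseteq> frontier F" "edge_segment e \<subseteq> frontier F'"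
      and F: "F \<in> faces L" "F' \<in> faces L" "F \<noteq> F'"
      using adj by (auto simp: adjacent_faces_def)
    obtain u v where uv: "e = {u, v}" "adjacent L u v" using e(1) by (rule edges_L_E)
    then have "adjacent lattice_graph u v" by (simp add: adjacent_L)
    then have "F = face (left_cell u v) \<or> F = face (left_cell v u)"
        "F' = face (left_cell u v) \<or> F' = face (left_cell v u)"
      using face_if_edge_subset_frontier F e uv by blast+
    then have "{F, F'} = {face (left_cell u v), face (left_cell v u)}"
      using F(3) by blast
    moreover have "\<phi> (face K) ! 1 = code (h K)" for K
      by (simp add: \<phi>_face)
    then have "\<phi> (face (left_cell u v)) \<noteq> \<phi> (face (left_cell v u))"
      using h_sides_distinct [OF uv(2)] by (metis code_inject)
    ultimately show ?thesis
      by (auto simp: doubleton_eq_iff)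
  qed
  have "corresponding_PFC L \<mu> \<phi>"
    unfolding corresponding_PFC_def
    using periodic_\<mu> perm unique proper clockwise_start_exists by simp
  then show ?thesis by blast
qed

lemma DETGC_\<mu>: "t \<Longrightarrow> DETGC L \<mu>"
  unfolding DETGC_def using ETGC_\<mu> directed_along_clockwise by metis

lemma RETGC_\<mu>: "\<not> t \<Longrightarrow> RETGC L \<mu>"
  unfolding RETGC_def using ETGC_\<mu> directed_along_clockwise by metis

end

context perfect_domination
begin

lemma colorings_exist:
  assumes belts: "\<And>F. F \<in> faces L \<Longrightarrow> \<exists>p. belt L F p \<and> 4 dvd length p"
  shows "(\<exists>\<mu>. DETGC L \<mu> \<and> (\<exists>\<phi>. corresponding_PFC L \<mu> \<phi>)) \<and>
         (\<exists>\<mu>. RETGC L \<mu> \<and> (\<exists>\<phi>. corresponding_PFC L \<mu> \<phi>))"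
proof -
  obtain h where h: "face_colored S L h"
    using face_coloring_exists perfect_domination_axioms
    by (metis face_colored_axioms_def face_colored_def)
  interpret face_colored S L h by (fact h)
  obtain c where c: "\<And>u v. adjacent L u v \<Longrightarrow> c u + c v = \<delta> u v"
    using vertex_coloring_exists belts by blast
  have col: "colored S L h c" for t
    by unfold_locales (use c belts in blast)+
  interpret D: colored S L h c True by (rule col)
  interpret R: colored S L h c False by (rule col)
  show ?thesis
    using D.DETGC_\<mu> [OF TrueI] D.corresponding_PFC_exists
      R.RETGC_\<mu> [OF not_False_eq_True [THEN iffD2, OF TrueI]] R.corresponding_PFC_exists by blast
qed

end

section \<open>Rectangular faces\<close>

text \<open>The counterclockwise boundary traversal of a lattice rectangle, by arc length from the lower
  left corner.\<close>

definition boundary_point :: "int \<Rightarrow> int \<Rightarrow> int \<Rightarrow> int \<Rightarrow> int \<Rightarrow> lattice_point" where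
  "boundary_point a a' b b' k =
     (if k < a' - a then (a + k, b)
      else if k < (a' - a) + (b' - b) then (a', b + (k - (a' - a)))
      else if k < 2 * (a' - a) + (b' - b) then (a' - (k - (a' - a) - (b' - b)), b')
      else (a, b' - (k - 2 * (a' - a) - (b' - b))))"

text \<open>The full cycle of boundary points, starting at the lower left corner \<open>(a, b)\<close>.\<close>

definition boundary_list :: "int \<Rightarrow> int \<Rightarrow> int \<Rightarrow> int \<Rightarrow> lattice_point list" where
  "boundary_list a a' b b' =
     map (\<lambda>i. boundary_point a a' b b' (int i)) [0..<nat (2 * ((a' - a) + (b' - b)))]"

lemma length_boundary_list: "length (boundary_list a a' b b') = nat (2 * ((a' - a) + (b' - b)))"
  by (simp add: boundary_list_def)

lemma distinct_boundary_list:
  assumes "a < a'" "b < b'"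
  shows "distinct (boundary_list a a' b b')"
proof -
  have "inj_on (\<lambda>i. boundary_point a a' b b' (int i)) {0..<nat (2 * ((a' - a) + (b' - b)))}"
  proof (rule inj_onI)
    fix i j
    assume "i \<in> {0..<nat (2 * ((a' - a) + (b' - b)))}" "j \<in> {0..<nat (2 * ((a' - a) + (b' - b)))}"
      and eq: "boundary_point a a' b b' (int i) = boundary_point a a' b b' (int j)"
    then have "int i < 2 * ((a' - a) + (b' - b))" "int j < 2 * ((a' - a) + (b' - b))"
      by auto
    then have "int i = int j"
      using eq assms unfolding boundary_point_def by (auto split: if_splits)
    then show "i = j" by simp
  qed
  then show ?thesis by (simp add: boundary_list_def distinct_map)
qed

lemma cyc_edges_boundary_list:
  assumes "a < a'" "b < b'"
  shows "cyc_edges (boundary_list a a' b b') =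
    (\<lambda>x. {(x, b), (x + 1, b)}) ` {a..<a'} \<union> (\<lambda>x. {(x, b'), (x + 1, b')}) ` {a..<a'} \<union>
    (\<lambda>y. {(a, y), (a, y + 1)}) ` {b..<b'} \<union> (\<lambda>y. {(a', y), (a', y + 1)}) ` {b..<b'}"
    (is "?l = ?r")
proof -
  define n where "n = 2 * ((a' - a) + (b' - b))"
  define r where "r = boundary_point a a' b b'"
  have n: "n > 0" using assms by (simp add: n_def)
  have nth: "cyc (boundary_list a a' b b') i = r (int (i mod nat n))" for i
    unfolding cyc_def length_boundary_list n_def [symmetric] boundary_list_def r_def
    using n by simp
  have edge: "cyc_edge (boundary_list a a' b b') i = {r (int i), r (int i + 1)}"
    if i: "i < nat n" for i
  proof -
    have "cyc (boundary_list a a' b b') (Suc i) = r (int i + 1)"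
    proof (cases "Suc i < nat n")
      case True
      then show ?thesis by (simp add: nth add.commute)
    next
      case False
      then have "Suc i = nat n" using i by simp
      then have "cyc (boundary_list a a' b b') (Suc i) = r 0" by (simp add: nth)
      moreover have "int i + 1 = n" using \<open>Suc i = nat n\<close> n by linarith
      then have "r (int i + 1) = r 0"
        using assms by (simp add: r_def boundary_point_def n_def)
      ultimately show ?thesis by simp
    qed
    then show ?thesis using i by (simp add: cyc_edge_def nth)
  qed
  have "?l = (\<lambda>i. {r (int i), r (int i + 1)}) ` {..<nat n}"
    unfolding cyc_edges_def length_boundary_list n_def [symmetric]
    by (intro image_cong refl edge) simp
  also have "\<dots> = (\<lambda>k. {r k, r (k + 1)}) ` {0..<n}"
  proof -
    have "{0..<n} = int ` {..<nat n}"
      using n by (simp add: lessThan_atLeast0 image_int_atLeastLessThan)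
    then show ?thesis by (simp add: image_image)
  qed
  also have "\<dots> = ?r"
  proof (intro equalityI subsetI)
    fix e assume "e \<in> (\<lambda>k. {r k, r (k + 1)}) ` {0..<n}"
    then obtain k where k: "0 \<le> k" "k < n" and e: "e = {r k, r (k + 1)}" by auto
    consider "k < a' - a" | "a' - a \<le> k" "k < (a' - a) + (b' - b)"
      | "(a' - a) + (b' - b) \<le> k" "k < 2 * (a' - a) + (b' - b)" | "2 * (a' - a) + (b' - b) \<le> k"
      by linarith
    then show "e \<in> ?r"
    proof cases
      case 1
      then have "e = {(a + k, b), (a + k + 1, b)}"
        using assms k by (auto simp: e r_def boundary_point_def)
      moreover have "a + k \<in> {a..<a'}" using 1 k by simp
      ultimately show ?thesis by blast
    next
      case 2
      define y where "y = b + (k - (a' - a))"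
      have "e = {(a', y), (a', y + 1)}"
        using assms k 2 by (auto simp: e r_def boundary_point_def y_def)
      moreover have "y \<in> {b..<b'}" using 2 k by (simp add: y_def)
      ultimately show ?thesis by blast
    next
      case 3
      define x where "x = a' - (k - (a' - a) - (b' - b)) - 1"
      have "e = {(x, b'), (x + 1, b')}"
        using assms k 3 by (auto simp: e r_def boundary_point_def x_def)
      moreover have "x \<in> {a..<a'}" using 3 k by (simp add: x_def)
      ultimately show ?thesis by blast
    next
      case 4
      define y where "y = b' - (k - 2 * (a' - a) - (b' - b)) - 1"
      have "e = {(a, y), (a, y + 1)}"
        using assms k 4 by (auto simp: e r_def boundary_point_def y_def)
      moreover have "y \<in> {b..<b'}" using 4 k by (simp add: y_def n_def)
      ultimately show ?thesis by blast
    qed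
  next
    fix e assume "e \<in> ?r"
    then consider x where "e = {(x, b), (x + 1, b)}" "a \<le> x" "x < a'"
      | x where "e = {(x, b'), (x + 1, b')}" "a \<le> x" "x < a'"
      | y where "e = {(a, y), (a, y + 1)}" "b \<le> y" "y < b'"
      | y where "e = {(a', y), (a', y + 1)}" "b \<le> y" "y < b'"
      by auto
    then show "e \<in> (\<lambda>k. {r k, r (k + 1)}) ` {0..<n}"
    proof cases
      case 1
      then show ?thesis using assms
        by (intro image_eqI [of _ _ "x - a"]) (auto simp: r_def boundary_point_def n_def)
    next
      case 2
      then show ?thesis using assms
        by (intro image_eqI [of _ _ "(a' - a) + (b' - b) + (a' - x - 1)"])
           (auto simp: r_def boundary_point_def n_def)
    next
      case 3
      then show ?thesis using assms
        by (intro image_eqI [of _ _ "2 * (a' - a) + (b' - b) + (b' - y - 1)"])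
           (auto simp: r_def boundary_point_def n_def)
    next
      case 4
      then show ?thesis using assms
        by (intro image_eqI [of _ _ "(a' - a) + (y - b)"])
           (auto simp: r_def boundary_point_def n_def)
    qed
  qed
  finally show ?thesis .
qed

lemma Union_unit_intervals:
  fixes a a' :: int
  assumes "a < a'"
  shows "(\<Union>x\<in>{a..<a'}. {real_of_int x..of_int x + 1}) = {of_int a..of_int a'}"
proof (intro equalityI subsetI)
  fix s assume "s \<in> (\<Union>x\<in>{a..<a'}. {real_of_int x..of_int x + 1})"
  then obtain x where "a \<le> x" "x < a'" "of_int x \<le> s" "s \<le> of_int x + 1" by auto
  then have "real_of_int a \<le> of_int x" "real_of_int x + 1 \<le> of_int a'" by linarith+
  then show "s \<in> {of_int a..of_int a'}"
    using \<open>of_int x \<le> s\<close> \<open>s \<le> of_int x + 1\<close> by auto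
next
  fix s assume s: "s \<in> {real_of_int a..of_int a'}"
  define x where "x = min \<lfloor>s\<rfloor> (a' - 1)"
  have "a \<le> \<lfloor>s\<rfloor>" using s by (simp add: le_floor_iff)
  then have "x \<in> {a..<a'}" using assms by (simp add: x_def)
  moreover have "of_int x \<le> s" "s \<le> of_int x + 1"
    using s by (auto simp: x_def min_def) linarith+
  ultimately show "s \<in> (\<Union>x\<in>{a..<a'}. {real_of_int x..of_int x + 1})" by auto
qed

lemma Union_segments_boundary_list:
  assumes "a < a'" "b < b'"
  shows "(\<Union>e \<in> cyc_edges (boundary_list a a' b b'). edge_segment e) =
    {of_int a..of_int a'} \<times> {of_int b, of_int b'} \<union> {of_int a, of_int a'} \<times> {of_int b..of_int b'}"
proof -
  have h: "(\<Union>x\<in>{a..<a'}. edge_segment {(x, y), (x + 1, y)}) = {of_int a..of_int a'} \<times> {of_int y}"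
    for y
    unfolding edge_segment_horizontal Union_unit_intervals [OF assms(1), symmetric] by blast
  have v: "(\<Union>y\<in>{b..<b'}. edge_segment {(x, y), (x, y + 1)}) = {of_int x} \<times> {of_int b..of_int b'}"
    for x
    unfolding edge_segment_vertical Union_unit_intervals [OF assms(2), symmetric] by blast
  show ?thesis
    unfolding cyc_edges_boundary_list [OF assms] UN_Un image_UN [symmetric] UN_simps(10) h v
    by auto
qed

context lattice_subgraph
begin

text \<open>
  The shape condition excludes rectangles of width 1 and larger length (or the converse), which have
  no lattice points in the interior and are crossed by edges of the subgraph.
\<close>

lemma rectangular_face:
  assumes ab: "a < a'" "b < b'"
    and boundary: "\<And>x y. a \<le> x \<Longrightarrow> x \<le> a' \<Longrightarrow> b \<le> y \<Longrightarrow> y \<le> b' \<Longrightarrow>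
      x = a \<or> x = a' \<or> y = b \<or> y = b' \<Longrightarrow> (x, y) \<notin> S"
    and interior: "\<And>x y. a < x \<Longrightarrow> x < a' \<Longrightarrow> b < y \<Longrightarrow> y < b' \<Longrightarrow> (x, y) \<in> S"
    and shape: "a' = a + 1 \<and> b' = b + 1 \<or> a + 2 \<le> a' \<and> b + 2 \<le> b'"
  shows "belt L ({of_int a<..<of_int a'} \<times> {of_int b<..<of_int b'}) (boundary_list a a' b b')"
    (is "belt L ?F ?p")
proof -
  have rab: "real_of_int a < of_int a'" "real_of_int b < of_int b'" using ab by simp_all
  have closure: "closure ?F = {of_int a..of_int a'} \<times> {of_int b..of_int b'}"
    using rab by (simp add: closure_Times)
  have "open ?F" by (intro open_Times open_greaterThanLessThan)
  then have frontier: "frontier ?F =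
      {of_int a..of_int a'} \<times> {of_int b, of_int b'} \<union> {of_int a, of_int a'} \<times> {of_int b..of_int b'}"
    unfolding frontier_def closure interior_open [OF \<open>open ?F\<close>] using rab by auto
  have edges: "cyc_edges ?p \<subseteq> edges L"
  proof -
    have "{(x, y), (x + 1, y)} \<in> edges L" if "a \<le> x" "x < a'" "y = b \<or> y = b'" for x y
    proof -
      have "adjacent L (x, y) (x + 1, y)"
        using boundary [of x y] boundary [of "x + 1" y] that ab
        by (auto simp: adjacent_L adjacent_lattice_graph)
      then show ?thesis by (simp add: adjacent_def)
    qed
    moreover have "{(x, y), (x, y + 1)} \<in> edges L" if "b \<le> y" "y < b'" "x = a \<or> x = a'" for x y
    proof -
      have "adjacent L (x, y) (x, y + 1)"
        using boundary [of x y] boundary [of x "y + 1"] that ab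
        by (auto simp: adjacent_L adjacent_lattice_graph)
      then show ?thesis by (simp add: adjacent_def)
    qed
    ultimately show ?thesis
      unfolding cyc_edges_boundary_list [OF ab] by auto
  qed
  have front: "frontier ?F = (\<Union>e \<in> cyc_edges ?p. edge_segment e)"
    unfolding frontier Union_segments_boundary_list [OF ab] ..
  have len: "length ?p \<ge> 3" using ab by (simp add: length_boundary_list)
  have cycle: "is_cycle L ?p"
    unfolding is_cycle_def
  proof (intro conjI)
    have "set ?p \<subseteq> \<Union> (cyc_edges ?p)"
      by (fastforce simp: set_conv_cyc cyc_edges_def cyc_edge_def)
    moreover have "e \<subseteq> verts L" if "e \<in> edges L" for e
      using that by (rule edges_L_E) (auto simp: adjacent_L verts_L)
    ultimately show "set ?p \<subseteq> verts L" using edges by blast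
  qed (use len distinct_boundary_list [OF ab] edges in auto)
  have "?F \<inter> drawing L = {}"
  proof -
    have False if ins: "of_int a < s" "s < of_int a'" "of_int b < u" "u < of_int b'"
      and draw: "(s, u) \<in> drawing L" for s u
      using draw
    proof (cases rule: drawing_cases)
      case (vertex x y)
      then show False using ins interior [of x y] by simp
    next
      case (horizontal x y)
      then have "a \<le> x" "x < a'" "b < y" "y < b'" using ins by linarith+
      moreover have "a + 2 \<le> a'" using shape \<open>b < y\<close> \<open>y < b'\<close> by auto
      ultimately show False
        using interior [of x y] interior [of "x + 1" y] horizontal by (cases "x = a") auto
    next
      case (vertical x y)
      then have "a < x" "x < a'" "b \<le> y" "y < b'" using ins by linarith+
      moreover have "b + 2 \<le> b'" using shape \<open>a < x\<close> \<open>x < a'\<close> by auto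
      ultimately show False
        using interior [of x y] interior [of x "y + 1"] vertical by (cases "y = b") auto
    qed
    then show ?thesis by auto
  qed
  moreover have "connected ?F" by (intro connected_Times connected_Ioo)
  moreover have "?F \<noteq> {}" using rab by simp
  moreover have "T = ?F" if T: "?F \<subseteq> T" "T \<subseteq> - drawing L" "connected T" for T
  proof (rule ccontr)
    assume "T \<noteq> ?F"
    then have "T \<inter> ?F \<noteq> {}" "T - ?F \<noteq> {}" using T(1) \<open>?F \<noteq> {}\<close> by blast+
    then have "T \<inter> frontier ?F \<noteq> {}"
      by (rule connected_Int_frontier [OF T(3)])
    moreover have "frontier ?F \<subseteq> drawing L"
      unfolding front drawing_def using edges by blast
    ultimately show False using T(2) by blast
  qed
  ultimately have "?F \<in> faces L"
    unfolding faces_def in_components_maximal by blast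
  then show ?thesis
    using cycle front by (simp add: belt_def)
qed

end

section \<open>Odd components\<close>

lemma interval_induct:
  fixes b b' :: int
  assumes "P y0" "b \<le> y0" "y0 \<le> b'"
    and step: "\<And>y. b \<le> y \<Longrightarrow> y < b' \<Longrightarrow> P y \<longleftrightarrow> P (y + 1)"
    and y: "b \<le> y" "y \<le> b'"
  shows "P y"
proof (cases "y0 \<le> y")
  case True
  then have "y \<le> b' \<longrightarrow> P y"
  proof (induction y rule: int_ge_induct)
    case (step i)
    then show ?case using assms(4) [of i] \<open>b \<le> y0\<close> by simp
  qed (use assms in simp)
  then show ?thesis using y by simp
next
  case False
  then have "y \<le> y0" by simp
  then have "b \<le> y \<longrightarrow> P y"
  proof (induction y rule: int_le_induct)
    case (step i)
    then show ?case using assms(4) [of "i - 1"] \<open>y0 \<le> b'\<close> by simp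
  qed (use assms in simp)
  then show ?thesis using y by simp
qed

context perfect_domination
begin

text \<open>
  If two opposite corners of a unit square are in the dominating set, then so are the other two, as
  each of these has two neighbors in the set.
\<close>

lemma diagonal:
  assumes "(x, y) \<in> S" "(x + 1, y + 1) \<in> S"
  shows "(x + 1, y) \<in> S" "(x, y + 1) \<in> S"
proof -
  show "(x + 1, y) \<in> S"
    by (rule ccontr, erule dominator_cases) (use assms in auto)
  show "(x, y + 1) \<in> S"
    by (rule ccontr, erule dominator_cases) (use assms in auto)
qed

lemma antidiagonal:
  assumes "(x + 1, y) \<in> S" "(x, y + 1) \<in> S"
  shows "(x, y) \<in> S" "(x + 1, y + 1) \<in> S"
proof -
  show "(x, y) \<in> S"
    by (rule ccontr, erule dominator_cases) (use assms in auto)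
  show "(x + 1, y + 1) \<in> S"
    by (rule ccontr, erule dominator_cases) (use assms in auto)
qed

text \<open>So a point of the set beside a vertical segment of the set forces the entire parallel segment,
  and likewise for horizontal segments.\<close>

lemma column_shift:
  assumes "(x, y) \<in> S" "(x, y + 1) \<in> S"
  shows "(x - 1, y) \<in> S \<longleftrightarrow> (x - 1, y + 1) \<in> S" "(x + 1, y) \<in> S \<longleftrightarrow> (x + 1, y + 1) \<in> S"
  using assms diagonal(2) [of "x - 1" y] antidiagonal(1) [of "x - 1" y] diagonal(1) [of x y]
    antidiagonal(2) [of x y] unfolding diff_add_cancel by blast+

lemma row_shift:
  assumes "(x, y) \<in> S" "(x + 1, y) \<in> S"
  shows "(x, y - 1) \<in> S \<longleftrightarrow> (x + 1, y - 1) \<in> S" "(x, y + 1) \<in> S \<longleftrightarrow> (x + 1, y + 1) \<in> S"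
  using assms diagonal(1) [of x "y - 1"] antidiagonal(1) [of x "y - 1"] diagonal(2) [of x y]
    antidiagonal(2) [of x y] unfolding diff_add_cancel by blast+

text \<open>The component of \<open>s\<close> in the subgraph induced by the dominating set.\<close>

definition component :: "lattice_point \<Rightarrow> lattice_point set" where
  "component s = {u. (adjacent (induced_subgraph lattice_graph S))\<^sup>*\<^sup>* s u}"

lemma adjacent_S:
  "adjacent (induced_subgraph lattice_graph S) u v \<longleftrightarrow> adjacent lattice_graph u v \<and> u \<in> S \<and> v \<in> S"
  by (auto simp: adjacent_def induced_subgraph_def)

lemma component_in: "s \<in> S \<Longrightarrow> component s \<in> graph_components (induced_subgraph lattice_graph S)"
  by (auto simp: graph_components_def component_def induced_subgraph_def lattice_graph_def)

lemma component_self: "s \<in> component s"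
  by (simp add: component_def)

lemma component_step:
  assumes "u \<in> component s" "adjacent lattice_graph u v" "u \<in> S" "v \<in> S"
  shows "v \<in> component s"
  using assms unfolding component_def
  by (metis adjacent_S mem_Collect_eq rtranclp.rtrancl_into_rtrancl)

lemma component_subset: "s \<in> S \<Longrightarrow> component s \<subseteq> S"
proof
  fix u assume "s \<in> S" "u \<in> component s"
  then have "(adjacent (induced_subgraph lattice_graph S))\<^sup>*\<^sup>* s u" by (simp add: component_def)
  then show "u \<in> S"
    using \<open>s \<in> S\<close> by (induction rule: rtranclp_induct) (auto simp: adjacent_S)
qed

text \<open>
  A rectangle of maximal size inside the component has no point of the dominating set next to it:
  one beside it would extend it by a row or column, and one at a corner would force one beside it.
  By connectedness the rectangle is the whole component.
\<close>

lemma finite_component_rectangle: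
  assumes s: "s \<in> S" and fin: "finite (component s)"
  obtains a a' b b' where "component s = {a..a'} \<times> {b..b'}" "a \<le> a'" "b \<le> b'"
    "\<And>x y. a - 1 \<le> x \<Longrightarrow> x \<le> a' + 1 \<Longrightarrow> b - 1 \<le> y \<Longrightarrow> y \<le> b' + 1 \<Longrightarrow>
       x = a - 1 \<or> x = a' + 1 \<or> y = b - 1 \<or> y = b' + 1 \<Longrightarrow> (x, y) \<notin> S"
proof -
  define Q where "Q = (\<lambda>(a, a', b, b'). s \<in> {a..a'} \<times> {b..b'} \<and> {a..a'} \<times> {b..b'} \<subseteq> component s)"
  define sz where "sz = (\<lambda>(a, a', b, b'). card ({a..a'} \<times> {b..b'} :: lattice_point set))"
  have "Q (fst s, fst s, snd s, snd s)"
    using component_self by (cases s) (auto simp: Q_def)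
  moreover have "sz r < Suc (card (component s))" if "Q r" for r
  proof -
    obtain a a' b b' where r_eq: "r = (a, a', b, b')" by (cases r)
    then show ?thesis
      using that card_mono [OF fin, of "{a..a'} \<times> {b..b'}"]
      by (simp add: Q_def sz_def less_Suc_eq_le)
  qed
  ultimately obtain r where r: "Q r" "\<And>r'. Q r' \<Longrightarrow> sz r' \<le> sz r"
    using ex_has_greatest_nat [of Q _ sz "Suc (card (component s))"] by metis
  obtain a a' b b' where r_eq: "r = (a, a', b, b')" by (cases r)
  define R where "R = {a..a'} \<times> {b..b'}"
  have sR: "s \<in> R" and RC: "R \<subseteq> component s"
    using r(1) by (auto simp: Q_def r_eq R_def)
  then have ab: "a \<le> a'" "b \<le> b'" by (auto simp: R_def)
  have RS: "R \<subseteq> S" using RC component_subset [OF s] by blast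
  have inS: "(x, y) \<in> S" if "a \<le> x" "x \<le> a'" "b \<le> y" "y \<le> b'" for x y
    using RS that by (auto simp: R_def)
  have max: "\<not> {c..c'} \<times> {d..d'} \<subseteq> component s"
    if sub: "R \<subset> {c..c'} \<times> {d..d'}" for c c' d d'
  proof
    assume "{c..c'} \<times> {d..d'} \<subseteq> component s"
    then have "sz (c, c', d, d') \<le> sz r"
      using sR sub by (intro r(2)) (auto simp: Q_def)
    moreover have "card R < card ({c..c'} \<times> {d..d'})"
      using sub by (intro psubset_card_mono) auto
    ultimately show False by (simp add: sz_def r_eq R_def)
  qed
  have left: "(a - 1, y) \<notin> S" if y: "b \<le> y" "y \<le> b'" for y
  proof
    assume "(a - 1, y) \<in> S"
    then have col: "(a - 1, z) \<in> S" if "b \<le> z" "z \<le> b'" for z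
      using interval_induct [of "\<lambda>z. (a - 1, z) \<in> S" y b b' z] y that column_shift(1) [of a] inS ab
      by auto
    have "{a - 1..a'} \<times> {b..b'} \<subseteq> component s"
    proof clarify
      fix x z assume xz: "x \<in> {a - 1..a'}" "z \<in> {b..b'}"
      show "(x, z) \<in> component s"
      proof (cases "x = a - 1")
        case True
        have "(a, z) \<in> component s" "(a, z) \<in> S" using xz ab RC RS by (auto simp: R_def)
        then show ?thesis
          using True component_step [of "(a, z)" s "(a - 1, z)"] col xz
          by (auto simp: adjacent_lattice_graph)
      qed (use xz RC in \<open>auto simp: R_def\<close>)
    qed
    moreover have "R \<subseteq> {a - 1..a'} \<times> {b..b'}" "(a - 1, b) \<in> {a - 1..a'} \<times> {b..b'} - R"
      using ab by (auto simp: R_def)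
    then have "R \<subset> {a - 1..a'} \<times> {b..b'}" by blast
    ultimately show False using max by blast
  qed
  have right: "(a' + 1, y) \<notin> S" if y: "b \<le> y" "y \<le> b'" for y
  proof
    assume "(a' + 1, y) \<in> S"
    then have col: "(a' + 1, z) \<in> S" if "b \<le> z" "z \<le> b'" for z
      using interval_induct [of "\<lambda>z. (a' + 1, z) \<in> S" y b b' z] y that column_shift(2) [of a'] inS ab
      by auto
    have "{a..a' + 1} \<times> {b..b'} \<subseteq> component s"
    proof clarify
      fix x z assume xz: "x \<in> {a..a' + 1}" "z \<in> {b..b'}"
      show "(x, z) \<in> component s"
      proof (cases "x = a' + 1")
        case True
        have "(a', z) \<in> component s" "(a', z) \<in> S" using xz ab RC RS by (auto simp: R_def)
        then show ?thesis
          using True component_step [of "(a', z)" s "(a' + 1, z)"] col xz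
          by (auto simp: adjacent_lattice_graph)
      qed (use xz RC in \<open>auto simp: R_def\<close>)
    qed
    moreover have "R \<subseteq> {a..a' + 1} \<times> {b..b'}" "(a' + 1, b) \<in> {a..a' + 1} \<times> {b..b'} - R"
      using ab by (auto simp: R_def)
    then have "R \<subset> {a..a' + 1} \<times> {b..b'}" by blast
    ultimately show False using max by blast
  qed
  have bottom: "(x, b - 1) \<notin> S" if x: "a \<le> x" "x \<le> a'" for x
  proof
    assume "(x, b - 1) \<in> S"
    then have row: "(z, b - 1) \<in> S" if "a \<le> z" "z \<le> a'" for z
      using interval_induct [of "\<lambda>z. (z, b - 1) \<in> S" x a a' z] x that row_shift(1) [of _ b] inS ab
      by auto
    have "{a..a'} \<times> {b - 1..b'} \<subseteq> component s"
    proof clarify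
      fix z y assume zy: "z \<in> {a..a'}" "y \<in> {b - 1..b'}"
      show "(z, y) \<in> component s"
      proof (cases "y = b - 1")
        case True
        have "(z, b) \<in> component s" "(z, b) \<in> S" using zy ab RC RS by (auto simp: R_def)
        then show ?thesis
          using True component_step [of "(z, b)" s "(z, b - 1)"] row zy
          by (auto simp: adjacent_lattice_graph)
      qed (use zy RC in \<open>auto simp: R_def\<close>)
    qed
    moreover have "R \<subseteq> {a..a'} \<times> {b - 1..b'}" "(a, b - 1) \<in> {a..a'} \<times> {b - 1..b'} - R"
      using ab by (auto simp: R_def)
    then have "R \<subset> {a..a'} \<times> {b - 1..b'}" by blast
    ultimately show False using max by blast
  qed
  have top: "(x, b' + 1) \<notin> S" if x: "a \<le> x" "x \<le> a'" for x
  proof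
    assume "(x, b' + 1) \<in> S"
    then have row: "(z, b' + 1) \<in> S" if "a \<le> z" "z \<le> a'" for z
      using interval_induct [of "\<lambda>z. (z, b' + 1) \<in> S" x a a' z] x that row_shift(2) [of _ b'] inS ab
      by auto
    have "{a..a'} \<times> {b..b' + 1} \<subseteq> component s"
    proof clarify
      fix z y assume zy: "z \<in> {a..a'}" "y \<in> {b..b' + 1}"
      show "(z, y) \<in> component s"
      proof (cases "y = b' + 1")
        case True
        have "(z, b') \<in> component s" "(z, b') \<in> S" using zy ab RC RS by (auto simp: R_def)
        then show ?thesis
          using True component_step [of "(z, b')" s "(z, b' + 1)"] row zy
          by (auto simp: adjacent_lattice_graph)
      qed (use zy RC in \<open>auto simp: R_def\<close>)
    qed
    moreover have "R \<subseteq> {a..a'} \<times> {b..b' + 1}" "(a, b' + 1) \<in> {a..a'} \<times> {b..b' + 1} - R"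
      using ab by (auto simp: R_def)
    then have "R \<subset> {a..a'} \<times> {b..b' + 1}" by blast
    ultimately show False using max by blast
  qed
  have corners: "(a - 1, b - 1) \<notin> S" "(a - 1, b' + 1) \<notin> S" "(a' + 1, b - 1) \<notin> S"
    "(a' + 1, b' + 1) \<notin> S"
    using diagonal [of "a - 1" "b - 1"] antidiagonal [of "a - 1" b'] antidiagonal [of a' "b - 1"]
      diagonal [of a' b'] left [of b] left [of b'] right [of b] right [of b'] ab
      inS [of a b] inS [of a b'] inS [of a' b] inS [of a' b']
    by auto
  have ring: "(x, y) \<notin> S" if "a - 1 \<le> x" "x \<le> a' + 1" "b - 1 \<le> y" "y \<le> b' + 1"
    "x = a - 1 \<or> x = a' + 1 \<or> y = b - 1 \<or> y = b' + 1" for x y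
  proof -
    have "x = a - 1 \<or> x = a' + 1 \<or> a \<le> x \<and> x \<le> a'" "y = b - 1 \<or> y = b' + 1 \<or> b \<le> y \<and> y \<le> b'"
      using that by linarith+
    then show ?thesis
      using left right bottom top corners that(5) by auto
  qed
  have "component s \<subseteq> R"
  proof
    fix u assume "u \<in> component s"
    then have "(adjacent (induced_subgraph lattice_graph S))\<^sup>*\<^sup>* s u" by (simp add: component_def)
    then show "u \<in> R"
    proof (induction rule: rtranclp_induct)
      case base
      then show ?case by (rule sR)
    next
      case (step v w)
      then have "adjacent lattice_graph v w" "w \<in> S" by (simp_all add: adjacent_S)
      obtain x y x' y' where vw: "v = (x, y)" "w = (x', y')" by (cases v; cases w)
      have "a \<le> x \<and> x \<le> a' \<and> b \<le> y \<and> y \<le> b'"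
        using step.IH by (simp add: vw R_def)
      moreover have "(x', y') \<in> {(x + 1, y), (x, y + 1), (x - 1, y), (x, y - 1)}"
        using \<open>adjacent lattice_graph v w\<close> by (simp add: vw adjacent_lattice_graph)
      ultimately have "a - 1 \<le> x' \<and> x' \<le> a' + 1 \<and> b - 1 \<le> y' \<and> y' \<le> b' + 1" by auto
      moreover have "\<not> (x' = a - 1 \<or> x' = a' + 1 \<or> y' = b - 1 \<or> y' = b' + 1)"
        using calculation ring [of x' y'] \<open>w \<in> S\<close> by (auto simp: vw)
      ultimately show ?case unfolding vw R_def mem_Times_iff fst_conv snd_conv atLeastAtMost_iff
        by linarith
    qed
  qed
  then have "component s = {a..a'} \<times> {b..b'}" using RC by (simp add: R_def)
  then show thesis using ab ring that by blast
qed

lemma odd_components_belts: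
  assumes odd: "odd_components lattice_graph S" and F: "F \<in> faces L"
  shows "\<exists>p. belt L F p \<and> 4 dvd length p"
proof -
  obtain K where K: "F = face K" using F by (rule faces_E)
  obtain x y where xy: "K = (x, y)" by (cases K)
  have in_F: "center K \<in> F"
    using K center_in_open_cell open_cell_subset_face by blast
  show ?thesis
  proof (cases "{(x, y), (x + 1, y), (x, y + 1), (x + 1, y + 1)} \<inter> S = {}")
    case True
    have "belt L ({of_int x<..<of_int (x + 1)} \<times> {of_int y<..<of_int (y + 1)})
        (boundary_list x (x + 1) y (y + 1))" (is "belt L ?G ?p")
    proof (rule rectangular_face)
      fix x' y' assume "x \<le> x'" "x' \<le> x + 1" "y \<le> y'" "y' \<le> y + 1"
      then have "x' = x \<or> x' = x + 1" "y' = y \<or> y' = y + 1" by linarith+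
      then show "(x', y') \<notin> S" using True by auto
    qed auto
    moreover have "center K \<in> ?G" by (simp add: xy center_def)
    with calculation have "F = ?G"
      unfolding belt_def by (intro faces_eqI [OF F _ in_F]) simp_all
    moreover have "4 dvd length ?p" by (simp add: length_boundary_list)
    ultimately show ?thesis by auto
  next
    case False
    then obtain s where s: "s \<in> S" "s \<in> {(x, y), (x + 1, y), (x, y + 1), (x + 1, y + 1)}" by blast
    have card: "odd (card (component s))"
      using odd component_in [OF s(1)] by (simp add: odd_components_def)
    then have "finite (component s)" by (metis card.infinite even_zero)
    with s(1) obtain a a' b b' where rect: "component s = {a..a'} \<times> {b..b'}" "a \<le> a'" "b \<le> b'"
      and ring: "\<And>x y. a - 1 \<le> x \<Longrightarrow> x \<le> a' + 1 \<Longrightarrow> b - 1 \<le> y \<Longrightarrow> y \<le> b' + 1 \<Longrightarrow>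
        x = a - 1 \<or> x = a' + 1 \<or> y = b - 1 \<or> y = b' + 1 \<Longrightarrow> (x, y) \<notin> S"
      using finite_component_rectangle by metis
    have "belt L ({of_int (a - 1)<..<of_int (a' + 1)} \<times> {of_int (b - 1)<..<of_int (b' + 1)})
        (boundary_list (a - 1) (a' + 1) (b - 1) (b' + 1))" (is "belt L ?G ?p")
    proof (rule rectangular_face)
      fix x' y' assume "a - 1 < x'" "x' < a' + 1" "b - 1 < y'" "y' < b' + 1"
      then have "(x', y') \<in> component s" by (simp add: rect)
      then show "(x', y') \<in> S" using component_subset [OF s(1)] by blast
    qed (use rect ring in auto)
    moreover have "center K \<in> ?G"
    proof -
      have "s \<in> {a..a'} \<times> {b..b'}" using component_self rect(1) by blast
      then have "a - 1 \<le> x" "x + 1 \<le> a' + 1" "b - 1 \<le> y" "y + 1 \<le> b' + 1"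
        using s(2) by auto
      then have "real_of_int (a - 1) \<le> of_int x" "real_of_int (x + 1) \<le> of_int (a' + 1)"
        "real_of_int (b - 1) \<le> of_int y" "real_of_int (y + 1) \<le> of_int (b' + 1)"
        unfolding of_int_le_iff by blast+
      then show ?thesis by (simp add: xy center_def)
    qed
    with calculation have "F = ?G"
      unfolding belt_def by (intro faces_eqI [OF F _ in_F]) simp_all
    moreover have "4 dvd length ?p"
    proof -
      have "card (component s) = nat (a' - a + 1) * nat (b' - b + 1)"
        by (simp add: rect card_cartesian_product)
      then have "odd (nat (a' - a + 1))" "odd (nat (b' - b + 1))" using card by simp_all
      then have "odd (a' - a + 1)" "odd (b' - b + 1)" using rect by (simp_all add: even_nat_iff)
      then have "even (a' - a)" "even (b' - b)" by simp_all
      then obtain i j where "a' - a = 2 * i" "b' - b = 2 * j" by (meson evenE)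
      moreover have "length ?p = nat (2 * ((a' - a) + (b' - b) + 4))"
        by (simp add: length_boundary_list)
      ultimately have "length ?p = nat (4 * (i + j + 2))" by simp
      also have "\<dots> = 4 * nat (i + j + 2)" by (simp add: nat_mult_distrib)
      finally show ?thesis by simp
    qed
    ultimately show ?thesis by auto
  qed
qed

end

theorem theorem60:
  fixes S :: "lattice_point set" and L :: "lattice_point graph"
  assumes "perfect_dominating_set lattice_graph S"
    and "L = delete_vertices lattice_graph S"
    and "belts_divisible_by_4 L \<or> odd_components lattice_graph S"
  shows "(\<exists>\<mu>. DETGC L \<mu> \<and> (\<exists>\<phi>. corresponding_PFC L \<mu> \<phi>)) \<and>
         (\<exists>\<mu>. RETGC L \<mu> \<and> (\<exists>\<phi>. corresponding_PFC L \<mu> \<phi>))"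
proof -
  interpret perfect_domination S L
    using assms by unfold_locales
  have "\<exists>p. belt L F p \<and> 4 dvd length p" if F: "F \<in> faces L" for F
    using assms(3)
  proof
    assume "belts_divisible_by_4 L"
    then show ?thesis
      using F unfolding belts_divisible_by_4_def planar_map_def by blast
  next
    assume "odd_components lattice_graph S"
    then show ?thesis using F by (rule odd_components_belts)
  qed
  then show ?thesis by (rule colorings_exist)
qed

end
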